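(* Let $\alpha,\beta\in(1,2)$ and let $d>0$, $e>0$ be constants (the case of constant diffusion coefficients $d_{\pm}=d$, $e_{\pm}=e$). For positive integers $n_1,n_2$ put $N=n_1n_2$. The coefficient matrix is then $$A_N=\mathbb{I}_{n_2}\otimes A_{n_1}^{\alpha}+A_{n_2}^{\beta}\otimes\mathbb{I}_{n_1},$$ where $$A_{n_1}^{\alpha}=T_{n_1}\!\left(\tfrac1r+d\,q_\alpha(\theta)\right)=\tfrac1r\mathbb{I}_{n_1}+T_{n_1}\!\left(d\,(w_\alpha(\theta)+w_\alpha(-\theta))\right),\qquad A_{n_2}^{\beta}=T_{n_2}\!\left(e\,\tfrac{s}{r}\,q_\beta(\theta)\right)=T_{n_2}\!\left(e\,\tfrac{s}{r}\,(w_\beta(\theta)+w_\beta(-\theta))\right).$$ Let $$\mathcal{P}_{\hat{\mathcal{F}}_{(\alpha,\beta)},N}=(\mathbb{S}_{n_2}\otimes\mathbb{S}_{n_1})\,\hat F_N\,(\mathbb{S}_{n_2}\otimes\mathbb{S}_{n_1}).$$ Then the spectrum of the preconditioned matrix sequence $\{\mathcal{P}_{\hat{\mathcal{F}}_{(\alpha,\beta)},N}^{-1}A_N\}_N$ is bounded by positive constants independent of $N$: there exist constants $0<c\le C<\infty$, independent of $N$ (that is, of $n_1$ and $n_2$), such that every eigenvalue of $\mathcal{P}_{\hat{\mathcal{F}}_{(\alpha,\beta)},N}^{-1}A_N$ lies in $[c,C]$.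
   Context: Setting: these matrices arise from a second-order (weighted and shifted Grünwald) spatial discretization with Crank–Nicolson time stepping of a two-dimensional fractional diffusion equation with fractional derivative orders $\alpha$ (in $x$) and $\beta$ (in $y$) on the rectangle $(L_1,R_1)\times(L_2,R_2)$ and time interval $(0,T)$. Discretization parameters: $h_x=\frac{R_1-L_1}{n_1+1}$, $h_y=\frac{R_2-L_2}{n_2+1}$, $h_t=T/M$ with $M$ the (positive integer) number of time steps, where $M$ may vary along the sequence, and $r=\frac{h_t}{2h_x^\alpha}>0$, $s=\frac{h_t}{2h_y^\beta}>0$. Thus $r$ and $s$ depend on the discretization. Toeplitz matrices: for $f\in L^1([-\pi,\pi])$ with Fourier coefficients $f_k=\frac1{2\pi}\int_{-\pi}^{\pi}f(\theta)e^{-\mathbf{i}k\theta}\,d\theta$, $T_n(f)=[f_{i-j}]_{i,j=1}^n$. $\mathbb{I}_n$ is the identity matrix of size $n$ and $\otimes$ is the Kronecker product. Symbols: for $\gamma\in(1,2)$, $$w_\gamma(\theta)=-\left(\frac{2-\gamma(1-e^{-\mathbf{i}\theta})}{2}\right)\left(1-e^{\mathbf{i}\theta}\right)^\gamma \quad\text{(principal branch of the power)},\qquad q_\gamma(\theta)=w_\gamma(\theta)+w_\gamma(-\theta).$$ Sine transform: $\mathbb{S}_n$ is the $n\times n$ symmetric orthogonal matrix $[\mathbb{S}_n]_{i,j}=\sqrt{\frac{2}{n+1}}\sin(i\,\theta_{j,n})$, where $\theta_{j,n}=\frac{j\pi}{n+1}$, $i,j=1,\dots,n$. The diagonal matrix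 $\hat F_N$: let $\hat{\mathcal{F}}_{(\alpha,\beta)}(\theta_1,\theta_2)=\frac1r+d\,q_\alpha(\theta_1)+\frac{s}{r}\,e\,q_\beta(\theta_2)$. Then $\hat F_N$ is the $N\times N$ block diagonal matrix with diagonal blocks $\hat F_{n_1,1},\dots,\hat F_{n_1,n_2}$, where $\hat F_{n_1,j}=\mathrm{diag}\big(\hat{\mathcal{F}}_{(\alpha,\beta)}(\theta_{i,n_1},\theta_{j,n_2}),\ i=1,\dots,n_1\big)$. Equivalently, $\hat F_N=\mathbb{I}_{n_2}\otimes F_{n_1}^\alpha+F_{n_2}^\beta\otimes\mathbb{I}_{n_1}$ with $F_{n_1}^\alpha=\mathrm{diag}_{i}\big(\frac1r+d\,q_\alpha(\theta_{i,n_1})\big)$ and $F_{n_2}^\beta=\mathrm{diag}_{j}\big(e\frac{s}{r}q_\beta(\theta_{j,n_2})\big)$. *)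

theory Defs
  imports "HOL-Analysis.Analysis" "Jordan_Normal_Form.Gauss_Jordan_Elimination"
    "Jordan_Normal_Form.Spectral_Radius"
begin

(* Complex powr is the principal branch exp (z * Ln w), with value 0 at w = 0,
   i.e. at angle 0, where the base 1 - exp (i * angle) vanishes. *)
definition w_symbol :: "real \<Rightarrow> real \<Rightarrow> complex" where
  "w_symbol \<gamma> \<theta> =
     - ((2 - of_real \<gamma> * (1 - exp (- (\<i> * of_real \<theta>)))) / 2) *
       (1 - exp (\<i> * of_real \<theta>)) powr of_real \<gamma>"

definition q_symbol :: "real \<Rightarrow> real \<Rightarrow> complex" where
  "q_symbol \<gamma> \<theta> = w_symbol \<gamma> \<theta> + w_symbol \<gamma> (- \<theta>)"

definition fourier_coeff :: "(real \<Rightarrow> complex) \<Rightarrow> int \<Rightarrow> complex" where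
  "fourier_coeff f k =
     1 / (2 * of_real pi) *
       (LINT \<theta>:{-pi..pi}|lebesgue. f \<theta> * exp (- (\<i> * of_int k * of_real \<theta>)))"

(* All matrix indices below start at 0, so index i stands for i + 1 in the usual notation. *)

definition toeplitz :: "nat \<Rightarrow> (real \<Rightarrow> complex) \<Rightarrow> complex Matrix.mat" where
  "toeplitz n f = Matrix.mat n n (\<lambda>(i, j). fourier_coeff f (int i - int j))"

definition kron :: "'a::semiring_0 Matrix.mat \<Rightarrow> 'a Matrix.mat \<Rightarrow> 'a Matrix.mat"
    (infixl "\<otimes>\<^sub>K" 75) where
  "A \<otimes>\<^sub>K B = Matrix.mat (dim_row A * dim_row B) (dim_col A * dim_col B)
     (\<lambda>(i, j). A $$ (i div dim_row B, j div dim_col B) * B $$ (i mod dim_row B, j mod dim_col B))"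

definition grid_angle :: "nat \<Rightarrow> nat \<Rightarrow> real" where
  "grid_angle n j = real j * pi / (real n + 1)"

definition sine_mat :: "nat \<Rightarrow> complex Matrix.mat" where
  "sine_mat n = Matrix.mat n n (\<lambda>(i, j).
     of_real (sqrt (2 / (real n + 1)) * sin (real (i + 1) * grid_angle n (j + 1))))"

(* Both r and s: the x direction gives r (order alpha, n = n_1), the y direction s (order beta,
   n = n_2). The uniform mesh has n interior points, and M is the number of time steps. *)
definition mesh_ratio :: "real \<Rightarrow> real \<Rightarrow> real \<Rightarrow> real \<Rightarrow> nat \<Rightarrow> nat \<Rightarrow> real" where
  "mesh_ratio \<gamma> L R T n M =
     (let h = (R - L) / (real n + 1); h\<^sub>t = T / real M in h\<^sub>t / (2 * h powr \<gamma>))"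

definition coeff_mat ::
    "real \<Rightarrow> real \<Rightarrow> real \<Rightarrow> real \<Rightarrow> real \<Rightarrow> real \<Rightarrow> nat \<Rightarrow> nat \<Rightarrow> complex Matrix.mat" where
  "coeff_mat \<alpha> \<beta> d e r s n\<^sub>1 n\<^sub>2 =
     1\<^sub>m n\<^sub>2 \<otimes>\<^sub>K toeplitz n\<^sub>1 (\<lambda>\<theta>. of_real (1 / r) + of_real d * q_symbol \<alpha> \<theta>) +
     toeplitz n\<^sub>2 (\<lambda>\<theta>. of_real (e * (s / r)) * q_symbol \<beta> \<theta>) \<otimes>\<^sub>K 1\<^sub>m n\<^sub>1"

definition F_symbol ::
    "real \<Rightarrow> real \<Rightarrow> real \<Rightarrow> real \<Rightarrow> real \<Rightarrow> real \<Rightarrow> real \<Rightarrow> real \<Rightarrow> complex" where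
  "F_symbol \<alpha> \<beta> d e r s \<theta>\<^sub>1 \<theta>\<^sub>2 =
     of_real (1 / r) + of_real d * q_symbol \<alpha> \<theta>\<^sub>1 + of_real (s / r * e) * q_symbol \<beta> \<theta>\<^sub>2"

(* Block j (size n_1) runs over the x grid at the j-th y grid point, matching the order of
   the Kronecker factors (y first) in coeff_mat and precond_mat. *)
definition F_mat ::
    "real \<Rightarrow> real \<Rightarrow> real \<Rightarrow> real \<Rightarrow> real \<Rightarrow> real \<Rightarrow> nat \<Rightarrow> nat \<Rightarrow> complex Matrix.mat" where
  "F_mat \<alpha> \<beta> d e r s n\<^sub>1 n\<^sub>2 = diag_block_mat (map (\<lambda>j.
     mat_diag n\<^sub>1 (\<lambda>i. F_symbol \<alpha> \<beta> d e r s (grid_angle n\<^sub>1 (i + 1)) (grid_angle n\<^sub>2 (j + 1))))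
     [0..<n\<^sub>2])"

definition precond_mat ::
    "real \<Rightarrow> real \<Rightarrow> real \<Rightarrow> real \<Rightarrow> real \<Rightarrow> real \<Rightarrow> nat \<Rightarrow> nat \<Rightarrow> complex Matrix.mat" where
  "precond_mat \<alpha> \<beta> d e r s n\<^sub>1 n\<^sub>2 =
     (sine_mat n\<^sub>2 \<otimes>\<^sub>K sine_mat n\<^sub>1) * F_mat \<alpha> \<beta> d e r s n\<^sub>1 n\<^sub>2 *
     (sine_mat n\<^sub>2 \<otimes>\<^sub>K sine_mat n\<^sub>1)"

end

theory Submission
  imports Defs
begin

text \<open>
  Up to a factor bounded above and below, the symbol \<open>q\<close> of order \<open>\<gamma>\<close> is \<open>m powr p\<close> with
  \<open>m t = 2 - 2 cos t\<close> and \<open>p = \<gamma> / 2 < 1\<close>. So one compares, on vectors supported in \<open>1..<L\<close>, the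
  Toeplitz form of \<open>m powr p\<close> (a compression of the \<open>p\<close>-th power of the Laplacian on the integers)
  with the form of the sine transform preconditioner (the \<open>p\<close>-th power of the Dirichlet Laplacian,
  which the sine transform diagonalises). For \<open>p = 0\<close> and \<open>p = 1\<close> the two forms agree. They are
  comparable in between by interpolation: \<open>x powr p\<close> is a superposition of the resolvents \<open>x / (x + l)\<close>,
  whose forms are minima over a splitting of the vector. Extending by zero bounds the Toeplitz form
  by the sine form, and a bounded reflection onto sequences vanishing at both ends gives the
  converse with constant 20. Kronecker sums preserve such two-sided bounds, and these bound the
  eigenvalues of the preconditioned matrix.
\<close>

section \<open>Fourier coefficients and Bessel inequality\<close>

text \<open>Compressing to \<open>1..<L\<close> and taking a fractional power do not commute, so the
  two forms have no common diagonalisation and cannot be compared frequency by frequency. The two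
  directions are of unequal difficulty. Extension by zero preserves norm and energy exactly, hence
  constant 1. Conversely, the optimal splitting on the Toeplitz side has Fourier coefficients on all
  integers, and cutting them off at the ends would create jumps that the energy does not control;
  the reflection repairs this at a fixed price. That price is 20 = 4 (3 + 2): 4 from squaring a sum
  of four terms, 3 for the sequence and its two mirror images, 2 for the slope of the cutoffs.

  The mesh ratios are never estimated. They enter only as the nonnegative weights
  \<open>1 / r\<close> and \<open>s / r\<close>, and each weighted term is compared on its own, so
  the final constant depends on the two orders alone and not even on \<open>d\<close> and
  \<open>e\<close>.\<close>

definition mean :: "(real \<Rightarrow> 'a::real_normed_vector) \<Rightarrow> 'a" where
  "mean f = (1 / (2 * pi)) *\<^sub>R integral {-pi..pi} f"

lemma mean_cmult_right:
  fixes f :: "real \<Rightarrow> 'a::{real_normed_field,banach}"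
  assumes "continuous_on {-pi..pi} f"
  shows "mean (\<lambda>t. c * f t) = c * mean f"
  unfolding mean_def using integrable_continuous_interval[OF assms]
  by (simp add: integral_mult)

lemma mean_add:
  fixes f g :: "real \<Rightarrow> 'a::banach"
  assumes "continuous_on {-pi..pi} f" "continuous_on {-pi..pi} g"
  shows "mean (\<lambda>t. f t + g t) = mean f + mean g"
  unfolding mean_def using assms
  by (simp add: integral_add integrable_continuous_interval scaleR_add_right)

lemma mean_diff:
  fixes f g :: "real \<Rightarrow> 'a::banach"
  assumes "continuous_on {-pi..pi} f" "continuous_on {-pi..pi} g"
  shows "mean (\<lambda>t. f t - g t) = mean f - mean g"
  unfolding mean_def using assms
  by (simp add: integral_diff integrable_continuous_interval scaleR_diff_right)

lemma mean_sum:
  fixes f :: "'i \<Rightarrow> real \<Rightarrow> 'a::banach"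
  assumes "finite X" "\<And>x. x \<in> X \<Longrightarrow> continuous_on {-pi..pi} (f x)"
  shows "mean (\<lambda>t. \<Sum>x\<in>X. f x t) = (\<Sum>x\<in>X. mean (f x))"
  unfolding mean_def using assms
  by (simp add: integral_sum integrable_continuous_interval scaleR_sum_right)

lemma mean_mono:
  fixes f g :: "real \<Rightarrow> real"
  assumes "continuous_on {-pi..pi} f" "continuous_on {-pi..pi} g"
    and "\<And>t. t \<in> {-pi..pi} \<Longrightarrow> f t \<le> g t"
  shows "mean f \<le> mean g"
  unfolding mean_def real_scaleR_def using assms
  by (intro mult_left_mono integral_le integrable_continuous_interval) auto

lemma mean_cong: "(\<And>t. t \<in> {-pi..pi} \<Longrightarrow> f t = g t) \<Longrightarrow> mean f = mean g"
  unfolding mean_def by (metis (no_types, lifting) integral_cong)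

lemma mean_of_real:
  assumes "continuous_on {-pi..pi} f"
  shows "mean (\<lambda>t. complex_of_real (f t)) = of_real (mean f)"
proof -
  have "((\<lambda>t. complex_of_real (f t)) has_integral of_real (integral {-pi..pi} f)) {-pi..pi}"
    using assms has_integral_of_real integrable_continuous_interval integrable_integral by blast
  then show ?thesis
    unfolding mean_def by (simp add: integral_unique scaleR_conv_of_real)
qed

lemma mean_Re:
  assumes "continuous_on {-pi..pi} f"
  shows "mean (\<lambda>t. Re (f t)) = Re (mean f)"
  unfolding mean_def using integral_linear[OF integrable_continuous_interval[OF assms] bounded_linear_Re]
  by (simp add: o_def)

lemma continuous_on_cis_mult [continuous_intros]:
  "continuous_on A (\<lambda>t. cis (c * t))"
  unfolding cis_conv_exp by (intro continuous_intros)

lemma mean_cis: "mean (\<lambda>t. cis (of_int k * t)) = (if k = 0 then 1 else 0)"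
proof (cases "k = 0")
  case True
  then show ?thesis by (simp add: mean_def scaleR_conv_of_real)
next
  case False
  have "((\<lambda>t. cis (of_int k * t)) has_integral
      Complex (sin (of_int k * pi) / of_int k) (- cos (of_int k * pi) / of_int k) -
      Complex (sin (of_int k * (-pi)) / of_int k) (- cos (of_int k * (-pi)) / of_int k)) {-pi..pi}"
  proof (rule fundamental_theorem_of_calculus)
    fix t :: real assume "t \<in> {-pi..pi}"
    show "((\<lambda>t. Complex (sin (of_int k * t) / of_int k) (- cos (of_int k * t) / of_int k))
        has_vector_derivative cis (of_int k * t)) (at t within {-pi..pi})"
      unfolding has_vector_derivative_complex_iff
      using False
      by (auto intro!: derivative_eq_intros simp: field_simps)
  qed auto
  moreover have "sin (of_int k * pi) = 0"
    by (metis mult.commute sin_npi_int)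
  ultimately have "integral {-pi..pi} (\<lambda>t. cis (of_int k * t)) = 0"
    by (simp add: integral_unique complex_eq_iff)
  then show ?thesis using False by (simp add: mean_def)
qed

definition trig :: "int set \<Rightarrow> (int \<Rightarrow> complex) \<Rightarrow> real \<Rightarrow> complex" where
  "trig X u t = (\<Sum>x\<in>X. u x * cis (of_int x * t))"

lemma continuous_on_trig [continuous_intros]: "continuous_on A (trig X u)"
  unfolding trig_def by (intro continuous_intros)

text \<open>The Fourier coefficient with the gauge integral of \<open>mean\<close> in place of the
  Lebesgue integral of \<open>fourier_coeff\<close>; for continuous functions the two agree.\<close>

definition coef :: "(real \<Rightarrow> complex) \<Rightarrow> int \<Rightarrow> complex" where
  "coef f x = mean (\<lambda>t. f t * cis (- of_int x * t))"

lemma coef_diff: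
  assumes "continuous_on {-pi..pi} f" "continuous_on {-pi..pi} g"
  shows "coef (\<lambda>t. f t - g t) x = coef f x - coef g x"
  unfolding coef_def using assms
  by (subst mean_diff[symmetric]) (auto intro!: continuous_intros simp: algebra_simps)

lemma coef_trig: "finite X \<Longrightarrow> coef (trig X u) x = (if x \<in> X then u x else 0)"
proof -
  assume "finite X"
  have "coef (trig X u) x = mean (\<lambda>t. \<Sum>y\<in>X. u y * cis (of_int (y - x) * t))"
    unfolding coef_def trig_def
    by (intro mean_cong) (simp add: sum_distrib_right mult.assoc cis_mult left_diff_distrib)
  also have "\<dots> = (\<Sum>y\<in>X. u y * mean (\<lambda>t. cis (of_int (y - x) * t)))"
    using \<open>finite X\<close> by (subst mean_sum) (auto intro!: continuous_intros simp del: of_int_diff simp: mean_cmult_right continuous_on_cis_mult)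
  also have "\<dots> = (\<Sum>y\<in>X. if y = x then u y else 0)"
    unfolding mean_cis by (intro sum.cong) auto
  finally show ?thesis using \<open>finite X\<close> by simp
qed

lemma mean_mult_cnj_trig:
  assumes "finite X" "continuous_on {-pi..pi} f"
  shows "mean (\<lambda>t. f t * cnj (trig X u t)) = (\<Sum>x\<in>X. coef f x * cnj (u x))"
proof -
  have "mean (\<lambda>t. f t * cnj (trig X u t)) = mean (\<lambda>t. \<Sum>x\<in>X. cnj (u x) * (f t * cis (- of_int x * t)))"
    unfolding trig_def by (intro mean_cong) (simp add: sum_distrib_left cis_cnj mult_ac)
  also have "\<dots> = (\<Sum>x\<in>X. cnj (u x) * coef f x)"
    using assms unfolding coef_def by (subst mean_sum)
      (auto intro!: continuous_intros sum.cong mean_cmult_right)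
  finally show ?thesis by (simp add: mult.commute)
qed

lemma parseval_trig:
  assumes "finite X"
  shows "mean (\<lambda>t. (cmod (trig X u t))\<^sup>2) = (\<Sum>x\<in>X. (cmod (u x))\<^sup>2)"
proof -
  have "complex_of_real (mean (\<lambda>t. (cmod (trig X u t))\<^sup>2)) = mean (\<lambda>t. trig X u t * cnj (trig X u t))"
    by (subst mean_of_real[symmetric])
      (auto intro!: continuous_intros simp: complex_norm_square simp flip: of_real_power)
  also have "\<dots> = (\<Sum>x\<in>X. u x * cnj (u x))"
    using assms by (simp add: mean_mult_cnj_trig continuous_on_trig coef_trig)
  also have "\<dots> = complex_of_real (\<Sum>x\<in>X. (cmod (u x))\<^sup>2)"
    by (simp add: complex_norm_square del: of_real_power)
  finally show ?thesis using of_real_eq_iff by blast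
qed

text \<open>The mean squared distance from \<open>f\<close> to its own partial Fourier sum is
  nonnegative. This inequality stands in for Parseval where the function is not a trigonometric
  polynomial, as for the optimal splitting on the Toeplitz side.\<close>

lemma bessel:
  assumes "finite X" "continuous_on {-pi..pi} f"
  shows "(\<Sum>x\<in>X. (cmod (coef f x))\<^sup>2) \<le> mean (\<lambda>t. (cmod (f t))\<^sup>2)"
proof -
  let ?T = "trig X (coef f)"
  have *: "Re (mean (\<lambda>t. f t * cnj (?T t))) = (\<Sum>x\<in>X. (cmod (coef f x))\<^sup>2)"
    unfolding mean_mult_cnj_trig[OF assms] complex_norm_square[symmetric] by (simp flip: of_real_power)
  have "mean (\<lambda>t. 0) \<le> mean (\<lambda>t. (cmod (f t - ?T t))\<^sup>2)"
    using assms by (intro mean_mono) (auto intro!: continuous_intros)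
  also have "\<dots> = mean (\<lambda>t. (cmod (f t))\<^sup>2 + (cmod (?T t))\<^sup>2 - 2 * Re (f t * cnj (?T t)))"
    by (intro mean_cong) (unfold cmod_power2, simp add: power2_eq_square algebra_simps)
  also have "\<dots> = mean (\<lambda>t. (cmod (f t))\<^sup>2 + (cmod (?T t))\<^sup>2) - mean (\<lambda>t. 2 * Re (f t * cnj (?T t)))"
    using assms by (intro mean_diff continuous_intros)
  also have "mean (\<lambda>t. 2 * Re (f t * cnj (?T t))) = 2 * mean (\<lambda>t. Re (f t * cnj (?T t)))"
    using assms by (intro mean_cmult_right continuous_intros)
  also have "mean (\<lambda>t. Re (f t * cnj (?T t))) = Re (mean (\<lambda>t. f t * cnj (?T t)))"
    using assms by (intro mean_Re continuous_intros)
  also have "mean (\<lambda>t. (cmod (f t))\<^sup>2 + (cmod (?T t))\<^sup>2) =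
      mean (\<lambda>t. (cmod (f t))\<^sup>2) + mean (\<lambda>t. (cmod (?T t))\<^sup>2)"
    using assms by (intro mean_add continuous_intros)
  also have "mean (\<lambda>t. (cmod (?T t))\<^sup>2) = (\<Sum>x\<in>X. (cmod (coef f x))\<^sup>2)"
    by (rule parseval_trig[OF assms(1)])
  finally have "0 \<le> mean (\<lambda>t. (cmod (f t))\<^sup>2) - (\<Sum>x\<in>X. (cmod (coef f x))\<^sup>2)"
    unfolding * by (simp add: mean_def)
  then show ?thesis by simp
qed

section \<open>Reflection and the discrete sine transform\<close>

lemma sum_telescope_int:
  fixes g :: "int \<Rightarrow> 'a::ab_group_add"
  assumes "a \<le> b"
  shows "(\<Sum>y\<in>{a..<b}. g (y + 1) - g y) = g b - g a"
  using assms
proof (induction b rule: int_ge_induct)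
  case (step b)
  have "{a..<b + 1} = insert b {a..<b}" using step.hyps by auto
  then show ?case using step.IH by (simp add: algebra_simps)
qed simp

lemma sum_reindex_le:
  fixes h :: "'b \<Rightarrow> real"
  assumes "inj_on g A" "g ` A \<subseteq> B" "finite B" "\<And>y. h y \<ge> 0"
  shows "(\<Sum>x\<in>A. h (g x)) \<le> sum h B"
  using assms by (metis (mono_tags, lifting) comp_apply sum.cong sum.reindex sum_mono2)

lemma norm_add_squared_le:
  fixes a b :: "'a::real_normed_vector"
  shows "(norm (a + b))\<^sup>2 \<le> 2 * ((norm a)\<^sup>2 + (norm b)\<^sup>2)"
proof -
  have "(norm (a + b))\<^sup>2 \<le> (norm a + norm b)\<^sup>2"
    by (simp add: norm_triangle_ineq power_mono)
  also have "\<dots> \<le> 2 * ((norm a)\<^sup>2 + (norm b)\<^sup>2)"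
    using sum_squares_bound[of "norm a" "norm b"] by (simp add: power2_sum)
  finally show ?thesis .
qed

lemma norm_add4_squared_le:
  fixes a b c d :: "'a::real_normed_vector"
  shows "(norm (a + b + c + d))\<^sup>2 \<le> 4 * ((norm a)\<^sup>2 + (norm b)\<^sup>2 + (norm c)\<^sup>2 + (norm d)\<^sup>2)"
  using norm_add_squared_le[of "a + b" "c + d"] norm_add_squared_le[of a b] norm_add_squared_le[of c d]
  by (simp add: add.assoc)

text \<open>A bounded retraction of sequences on the integers onto those vanishing at \<open>0\<close> and \<open>L\<close>:
  subtract the mirror images in both end points, each weighted by a linear cutoff. It fixes sequences
  supported in \<open>1..<L\<close>, and it is bounded both in norm and in Dirichlet energy, uniformly in \<open>L\<close>.\<close>

definition reflect :: "int \<Rightarrow> (int \<Rightarrow> complex) \<Rightarrow> int \<Rightarrow> complex" where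
  "reflect L v x = v x - of_real (1 - x / L) * v (- x) - of_real (x / L) * v (2 * L - x)"

lemma reflect_diff: "reflect L (\<lambda>x. v x - w x) x = reflect L v x - reflect L w x"
  by (simp add: reflect_def algebra_simps)

lemma reflect_0: "L > 0 \<Longrightarrow> reflect L v 0 = 0"
  by (simp add: reflect_def)

lemma reflect_L: "L > 0 \<Longrightarrow> reflect L v L = 0"
  by (simp add: reflect_def)

lemma cmod_scale_le: "0 \<le> c \<Longrightarrow> c \<le> 1 \<Longrightarrow> (cmod (of_real c * z))\<^sup>2 \<le> (cmod z)\<^sup>2"
  by (intro power_mono) (simp_all add: norm_mult mult_left_le_one_le)

text \<open>All weights lie in [0, 1], and \<open>x\<close>, \<open>-x\<close> and
  \<open>2 * L - x\<close> each run injectively through the window \<open>-L..2*L\<close>. Counting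
  gives 4 * 3 = 12; the bound is stated with 20 so that norm and energy carry the same factor
  through the interpolation.\<close>

lemma reflect_l2:
  assumes "L > 0"
  shows "(\<Sum>x\<in>{1..<L}. (cmod (reflect L v x))\<^sup>2) \<le> 20 * (\<Sum>x\<in>{-L..2*L}. (cmod (v x))\<^sup>2)"
    (is "_ \<le> 20 * ?E")
proof -
  have "(\<Sum>x\<in>{1..<L}. (cmod (reflect L v x))\<^sup>2) \<le>
      (\<Sum>x\<in>{1..<L}. 4 * ((cmod (v x))\<^sup>2 + (cmod (v (-x)))\<^sup>2 + (cmod (v (2 * L - x)))\<^sup>2))"
  proof (rule sum_mono)
    fix x assume x: "x \<in> {1..<L}"
    let ?a = "- (of_real (1 - x / L) * v (- x))" and ?b = "- (of_real (x / L) * v (2 * L - x))"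
    have "(cmod (reflect L v x))\<^sup>2 = (cmod (v x + ?a + ?b + 0))\<^sup>2"
      by (simp add: reflect_def)
    also have "\<dots> \<le> 4 * ((cmod (v x))\<^sup>2 + (cmod ?a)\<^sup>2 + (cmod ?b)\<^sup>2 + (cmod 0)\<^sup>2)"
      by (rule norm_add4_squared_le)
    also have "\<dots> = 4 * ((cmod (v x))\<^sup>2 + (cmod ?a)\<^sup>2 + (cmod ?b)\<^sup>2)"
      by simp
    also have "\<dots> \<le> 4 * ((cmod (v x))\<^sup>2 + (cmod (v (-x)))\<^sup>2 + (cmod (v (2 * L - x)))\<^sup>2)"
      using x unfolding norm_minus_cancel
      by (intro mult_left_mono add_mono order_refl cmod_scale_le) auto
    finally show "(cmod (reflect L v x))\<^sup>2 \<le>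
        4 * ((cmod (v x))\<^sup>2 + (cmod (v (-x)))\<^sup>2 + (cmod (v (2 * L - x)))\<^sup>2)" .
  qed
  also have "\<dots> = 4 * ((\<Sum>x\<in>{1..<L}. (cmod (v x))\<^sup>2) + (\<Sum>x\<in>{1..<L}. (cmod (v (-x)))\<^sup>2) +
      (\<Sum>x\<in>{1..<L}. (cmod (v (2 * L - x)))\<^sup>2))"
    by (simp add: sum.distrib flip: sum_distrib_left)
  also have "(\<Sum>x\<in>{1..<L}. (cmod (v x))\<^sup>2) \<le> ?E"
    by (rule sum_reindex_le[of "\<lambda>x. x"]) auto
  also have "(\<Sum>x\<in>{1..<L}. (cmod (v (-x)))\<^sup>2) \<le> ?E"
    by (rule sum_reindex_le[of "\<lambda>x. -x"]) auto
  also have "(\<Sum>x\<in>{1..<L}. (cmod (v (2 * L - x)))\<^sup>2) \<le> ?E"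
    by (rule sum_reindex_le[of "\<lambda>x. 2 * L - x"]) (auto simp: inj_on_def)
  finally show ?thesis
    using sum_nonneg[of "{-L..2*L}" "\<lambda>x. (cmod (v x))\<^sup>2"] by simp
qed

text \<open>Cauchy-Schwarz for a telescoping sum. The factor \<open>b - a\<close>, which is
  \<open>2 * L\<close> in the application, is absorbed by the slope \<open>1 / L\<close> of the
  cutoffs.\<close>

lemma increment_squared_le:
  fixes v :: "int \<Rightarrow> complex"
  assumes "a \<le> b"
  shows "(cmod (v b - v a))\<^sup>2 \<le> of_int (b - a) * (\<Sum>y\<in>{a..<b}. (cmod (v (y + 1) - v y))\<^sup>2)"
proof -
  have "(cmod (v b - v a))\<^sup>2 = (cmod (\<Sum>y\<in>{a..<b}. v (y + 1) - v y))\<^sup>2"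
    using assms by (simp add: sum_telescope_int)
  also have "\<dots> \<le> (\<Sum>y\<in>{a..<b}. cmod (v (y + 1) - v y))\<^sup>2"
    by (intro power_mono norm_sum) auto
  also have "\<dots> \<le> (\<Sum>y\<in>{a..<b}. (cmod (v (y + 1) - v y))\<^sup>2) * card {a..<b}"
    by (rule sum_squared_le_sum_of_squares)
  finally show ?thesis using assms by (simp add: mult.commute)
qed

text \<open>A discrete product rule leaves three increments of \<open>v\<close> with weights in
  [0, 1], plus the terms where a cutoff is differenced. As the two cutoffs add up to 1, the latter
  merge into the single difference \<open>v (2 * L - x) - v (- x)\<close> times
  \<open>- 1 / L\<close>, which the energy controls as well.\<close>

lemma reflect_energy:
  assumes "L > 0"
  shows "(\<Sum>x\<in>{0..<L}. (cmod (reflect L v (x + 1) - reflect L v x))\<^sup>2) \<le>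
    20 * (\<Sum>y\<in>{-L..<2*L}. (cmod (v (y + 1) - v y))\<^sup>2)" (is "_ \<le> 20 * ?E")
proof -
  let ?D = "\<lambda>y. v (y + 1) - v y"
  have "(\<Sum>x\<in>{0..<L}. (cmod (reflect L v (x + 1) - reflect L v x))\<^sup>2) \<le>
      (\<Sum>x\<in>{0..<L}. 4 * ((cmod (?D x))\<^sup>2 + (cmod (?D (- x - 1)))\<^sup>2 + (cmod (?D (2 * L - x - 1)))\<^sup>2
        + 2 / L * ?E))"
  proof (rule sum_mono)
    fix x assume x: "x \<in> {0..<L}"
    let ?a = "?D x" and ?b = "of_real (1 - (x + 1) / L) * ?D (- x - 1)"
      and ?c = "of_real ((x + 1) / L) * ?D (2 * L - x - 1)"
      and ?d = "of_real (- 1 / L) * (v (2 * L - x) - v (- x))"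
    have "reflect L v (x + 1) - reflect L v x = ?a + ?b + ?c + ?d"
    proof -
      define p q where "p = complex_of_real (x / L)" and "q = complex_of_real (1 / L)"
      have *: "2 * L - (x + 1) = 2 * L - x - 1" "2 * L - x - 1 + 1 = 2 * L - x"
        "- (x + 1) = - x - 1" "- x - 1 + 1 = - x" by simp_all
      have coeffs: "complex_of_real (of_int (x + 1) / L) = p + q" "complex_of_real (- 1 / L) = - q"
        "complex_of_real (1 - of_int (x + 1) / L) = 1 - (p + q)" "complex_of_real (1 - x / L) = 1 - p"
        by (simp_all add: p_def q_def add_divide_distrib)
      have coeffs': "complex_of_real ((of_int x + 1) / L) = p + q"
        "complex_of_real (1 - (of_int x + 1) / L) = 1 - (p + q)"
        using coeffs by simp_all
      show ?thesis
        unfolding reflect_def * coeffs coeffs' p_def[symmetric]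
        by (simp only: ring_distribs mult_minus_left) simp
    qed
    then have "(cmod (reflect L v (x + 1) - reflect L v x))\<^sup>2 \<le>
        4 * ((cmod ?a)\<^sup>2 + (cmod ?b)\<^sup>2 + (cmod ?c)\<^sup>2 + (cmod ?d)\<^sup>2)"
      by (simp only: norm_add4_squared_le)
    moreover have "(cmod ?b)\<^sup>2 \<le> (cmod (?D (- x - 1)))\<^sup>2"
      using x by (intro cmod_scale_le) (auto simp: field_simps)
    moreover have "(cmod ?c)\<^sup>2 \<le> (cmod (?D (2 * L - x - 1)))\<^sup>2"
      using x by (intro cmod_scale_le) (auto simp: field_simps)
    \<comment> \<open>The increment over distance \<open>2 * L\<close> costs \<open>2 * L\<close>
      times the energy and the slope contributes \<open>1 / L\<^sup>2\<close>; summed over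
      \<open>L\<close> points this amounts to twice the energy.\<close>
    moreover have "(cmod ?d)\<^sup>2 \<le> 2 / L * ?E"
    proof -
      define E where "E = ?E"
      have "(cmod ?d)\<^sup>2 = (cmod (v (2 * L - x) - v (- x)))\<^sup>2 / L\<^sup>2"
        by (simp add: norm_mult norm_divide power_mult_distrib power_divide)
      also have "\<dots> \<le> (of_int (2 * L - x - - x) * (\<Sum>y\<in>{-x..<2*L-x}. (cmod (?D y))\<^sup>2)) / L\<^sup>2"
        using assms by (intro divide_right_mono increment_squared_le) auto
      also have "\<dots> \<le> (of_int (2 * L - x - - x) * E) / L\<^sup>2"
        unfolding E_def using x assms by (intro divide_right_mono mult_left_mono sum_mono2) auto
      also have "\<dots> = 2 / L * E"
        using assms by (simp add: power2_eq_square)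
      finally show ?thesis
        unfolding E_def .
    qed
    ultimately show "(cmod (reflect L v (x + 1) - reflect L v x))\<^sup>2 \<le>
        4 * ((cmod (?D x))\<^sup>2 + (cmod (?D (- x - 1)))\<^sup>2 + (cmod (?D (2 * L - x - 1)))\<^sup>2 + 2 / L * ?E)"
      by (elim order_trans, intro mult_left_mono add_mono) auto
  qed
  also have "\<dots> = 4 * ((\<Sum>x\<in>{0..<L}. (cmod (?D x))\<^sup>2) + (\<Sum>x\<in>{0..<L}. (cmod (?D (- x - 1)))\<^sup>2) +
      (\<Sum>x\<in>{0..<L}. (cmod (?D (2 * L - x - 1)))\<^sup>2) + (\<Sum>x\<in>{0..<L}. 2 / L * ?E))"
    by (simp only: sum.distrib sum_distrib_left[symmetric])
  also have "(\<Sum>x\<in>{0..<L}. 2 / L * ?E) = 2 * ?E"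
    using assms by simp
  also have "(\<Sum>x\<in>{0..<L}. (cmod (?D x))\<^sup>2) \<le> ?E"
    using assms by (intro sum_mono2) auto
  also have "(\<Sum>x\<in>{0..<L}. (cmod (?D (- x - 1)))\<^sup>2) \<le> ?E"
    by (rule sum_reindex_le[of "\<lambda>x. - x - 1"]) (auto simp: inj_on_def)
  also have "(\<Sum>x\<in>{0..<L}. (cmod (?D (2 * L - x - 1)))\<^sup>2) \<le> ?E"
    by (rule sum_reindex_le[of "\<lambda>x. 2 * L - x - 1"]) (auto simp: inj_on_def)
  finally show ?thesis by simp
qed

section \<open>Orthogonality of the sine vectors and the Dirichlet Laplacian\<close>

lemma sin_of_int_mult_pi: "sin (of_int m * pi) = (0 :: real)"
  by (metis mult.commute sin_npi_int)

lemma cos_of_int_mult_pi: "cos (of_int m * pi) = (if even m then 1 else - 1 :: real)"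
  by (metis mult.commute cos_npi_int)

text \<open>Multiplication by \<open>2 * sin (a / 2)\<close> makes the sum telescope; the hypotheses
  put \<open>a / 2\<close> strictly between 0 and pi, so that this factor can be divided
  out.\<close>

lemma sum_cos_grid:
  assumes "0 < m" "m < 2 * L"
  shows "(\<Sum>k\<in>{0..<L}. cos (of_int (m * k) * pi / of_int L)) = (if even m then 0 else 1)"
proof -
  define a where "a = of_int m * pi / of_int L"
  have L: "L > 0" using assms by linarith
  have "a / 2 < pi" "a / 2 > 0"
    using assms L unfolding a_def by (simp_all add: field_simps)
  then have s: "sin (a / 2) \<noteq> 0" using sin_gt_zero by fastforce
  have La: "of_int L * a = of_int m * pi"
    using L unfolding a_def by simp
  have "2 * sin (a / 2) * (\<Sum>k\<in>{0..<L}. cos (of_int (m * k) * pi / of_int L)) =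
     (\<Sum>k\<in>{0..<L}. sin (of_int (k + 1) * a - a / 2) - sin (of_int k * a - a / 2))"
    unfolding sum_distrib_left
  proof (rule sum.cong[OF refl])
    fix k
    have "of_int (m * k) * pi / of_int L = of_int k * a" by (simp add: a_def)
    moreover have "sin (of_int (k + 1) * a - a / 2) = sin (of_int k * a + a / 2)"
      by (simp add: algebra_simps)
    ultimately show "2 * sin (a / 2) * cos (of_int (m * k) * pi / of_int L) =
        sin (of_int (k + 1) * a - a / 2) - sin (of_int k * a - a / 2)"
      by (simp add: sin_add sin_diff)
  qed
  also have "\<dots> = sin (of_int L * a - a / 2) + sin (a / 2)"
    using L by (subst sum_telescope_int) auto
  also have "sin (of_int L * a - a / 2) = - cos (of_int m * pi) * sin (a / 2)"
    unfolding La sin_diff by (simp add: sin_of_int_mult_pi)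
  also have "cos (of_int m * pi) = (if even m then 1 else - 1 :: real)"
    by (simp add: cos_of_int_mult_pi)
  finally have "2 * sin (a / 2) * (\<Sum>k\<in>{0..<L}. cos (of_int (m * k) * pi / of_int L)) =
      2 * sin (a / 2) * (if even m then 0 else 1)" by auto
  then show ?thesis using s by simp
qed

text \<open>Integer indices with \<open>L = n + 1\<close> keep the boundary positions 0 and
  \<open>L\<close> in reach. The entries vanish there, which is the Dirichlet condition that
  summation by parts asks for.\<close>

definition dst_entry :: "int \<Rightarrow> int \<Rightarrow> int \<Rightarrow> real" where
  "dst_entry L i k = sqrt (2 / of_int L) * sin (of_int (i * k) * pi / of_int L)"

lemma dst_entry_commute: "dst_entry L i k = dst_entry L k i"
  by (simp add: dst_entry_def mult.commute)

lemma dst_entry_0: "dst_entry L j 0 = 0"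
  by (simp add: dst_entry_def)

lemma dst_entry_L: "L > 0 \<Longrightarrow> dst_entry L j L = 0"
  by (simp add: dst_entry_def sin_of_int_mult_pi)

text \<open>The product formula for sines gives cosine sums at \<open>i - j\<close> and
  \<open>i + j\<close>. These numbers have equal parity, so for distinct indices the sums cancel,
  while on the diagonal the first one is \<open>L\<close> and the second 0.\<close>

lemma dst_entry_orthonormal:
  assumes "i \<in> {1..<L}" "j \<in> {1..<L}"
  shows "(\<Sum>k\<in>{1..<L}. dst_entry L i k * dst_entry L j k) = (if i = j then 1 else 0)"
proof -
  have L: "L > 0" using assms by auto
  let ?c = "\<lambda>m k. cos (of_int (m * k) * pi / of_int L)"
  have "(\<Sum>k\<in>{1..<L}. dst_entry L i k * dst_entry L j k) =
      (\<Sum>k\<in>{0..<L}. dst_entry L i k * dst_entry L j k)"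
  proof (rule sum.mono_neutral_left)
    show "\<forall>k\<in>{0..<L} - {1..<L}. dst_entry L i k * dst_entry L j k = 0"
    proof
      fix k assume "k \<in> {0..<L} - {1..<L}"
      then have "k = 0" by auto
      then show "dst_entry L i k * dst_entry L j k = 0" by (simp add: dst_entry_0)
    qed
  qed auto
  also have "\<dots> = (\<Sum>k\<in>{0..<L}. 1 / L * (?c \<bar>i - j\<bar> k - ?c (i + j) k))"
  proof (rule sum.cong[OF refl])
    fix k
    have "?c \<bar>i - j\<bar> k = ?c (i - j) k"
    proof (cases "i \<ge> j")
      case False
      then have "of_int (\<bar>i - j\<bar> * k) * pi / real_of_int L = - (of_int ((i - j) * k) * pi / of_int L)"
        by (simp add: algebra_simps diff_divide_distrib)
      then show ?thesis by (simp only: cos_minus)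
    qed simp
    moreover have "of_int ((i - j) * k) * pi / real_of_int L =
        of_int (i * k) * pi / of_int L - of_int (j * k) * pi / of_int L"
      "of_int ((i + j) * k) * pi / real_of_int L =
        of_int (i * k) * pi / of_int L + of_int (j * k) * pi / of_int L"
      by (simp_all add: algebra_simps diff_divide_distrib add_divide_distrib)
    moreover have "dst_entry L i k * dst_entry L j k = sqrt (2 / L) * sqrt (2 / L) *
        (sin (of_int (i * k) * pi / of_int L) * sin (of_int (j * k) * pi / of_int L))"
      by (simp only: dst_entry_def mult_ac)
    moreover have "sqrt (2 / L) * sqrt (2 / L) = 2 / L" using L by simp
    ultimately show "dst_entry L i k * dst_entry L j k = 1 / L * (?c \<bar>i - j\<bar> k - ?c (i + j) k)"
      by (simp only: cos_add cos_diff) simp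
  qed
  also have "\<dots> = 1 / L * ((\<Sum>k\<in>{0..<L}. ?c \<bar>i - j\<bar> k) - (\<Sum>k\<in>{0..<L}. ?c (i + j) k))"
    by (simp only: sum_distrib_left[symmetric] sum_subtractf)
  also have "(\<Sum>k\<in>{0..<L}. ?c (i + j) k) = (if even (i + j) then 0 else 1)"
    using assms by (intro sum_cos_grid) auto
  also have "(\<Sum>k\<in>{0..<L}. ?c \<bar>i - j\<bar> k) = (if i = j then L else if even (i + j) then 0 else 1)"
  proof (cases "i = j")
    case False
    then have "(\<Sum>k\<in>{0..<L}. ?c \<bar>i - j\<bar> k) = (if even \<bar>i - j\<bar> then 0 else 1)"
      using assms by (intro sum_cos_grid) auto
    with False show ?thesis by simp
  qed (use L in simp)
  finally show ?thesis using L by auto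
qed

definition dst :: "int \<Rightarrow> (int \<Rightarrow> complex) \<Rightarrow> int \<Rightarrow> complex" where
  "dst L u j = (\<Sum>x\<in>{1..<L}. of_real (dst_entry L j x) * u x)"

lemma dst_dst:
  assumes "x \<in> {1..<L}"
  shows "dst L (dst L u) x = u x"
proof -
  have "dst L (dst L u) x =
      (\<Sum>j\<in>{1..<L}. \<Sum>y\<in>{1..<L}. of_real (dst_entry L x j * dst_entry L y j) * u y)"
    by (simp add: dst_def sum_distrib_left mult.assoc dst_entry_commute)
  also have "\<dots> = (\<Sum>y\<in>{1..<L}. of_real (\<Sum>j\<in>{1..<L}. dst_entry L x j * dst_entry L y j) * u y)"
    by (subst sum.swap) (simp add: sum_distrib_right)
  also have "\<dots> = (\<Sum>y\<in>{1..<L}. if y = x then u y else 0)"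
    using assms by (intro sum.cong) (simp_all add: dst_entry_orthonormal)
  finally show ?thesis using assms by simp
qed

lemma dst_parseval_inner:
  "(\<Sum>j\<in>{1..<L}. cnj (dst L u j) * dst L w j) = (\<Sum>x\<in>{1..<L}. cnj (u x) * w x)"
proof -
  have "(\<Sum>j\<in>{1..<L}. cnj (dst L u j) * dst L w j) =
      (\<Sum>j\<in>{1..<L}. \<Sum>x\<in>{1..<L}. cnj (u x) * (of_real (dst_entry L x j) * dst L w j))"
    by (simp add: dst_def[of L u] sum_distrib_left sum_distrib_right dst_entry_commute mult_ac)
  also have "\<dots> = (\<Sum>x\<in>{1..<L}. cnj (u x) * dst L (dst L w) x)"
    by (subst sum.swap) (simp add: dst_def[of L "dst L w"] sum_distrib_left)
  also have "\<dots> = (\<Sum>x\<in>{1..<L}. cnj (u x) * w x)"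
    by (intro sum.cong) (simp_all add: dst_dst)
  finally show ?thesis .
qed

lemma dst_parseval:
  "(\<Sum>j\<in>{1..<L}. (cmod (dst L u j))\<^sup>2) = (\<Sum>x\<in>{1..<L}. (cmod (u x))\<^sup>2)"
proof -
  have "complex_of_real (\<Sum>j\<in>{1..<L}. (cmod (dst L u j))\<^sup>2) = of_real (\<Sum>x\<in>{1..<L}. (cmod (u x))\<^sup>2)"
    using dst_parseval_inner[of L u u] by (simp add: complex_norm_square mult.commute del: of_real_power)
  then show ?thesis using of_real_eq_iff by blast
qed

lemma dst_diff: "dst L (\<lambda>x. u x - w x) j = dst L u j - dst L w j"
  by (simp add: dst_def algebra_simps sum_subtractf)

text \<open>The boundary conditions concern \<open>f\<close> alone, so the identity can be used in
  both directions: with a sine row in the place of \<open>f\<close>, and then with \<open>u\<close>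
  in the place of \<open>f\<close> and the sine row in that of \<open>g\<close>.\<close>

lemma sum_by_parts_int:
  fixes f g :: "int \<Rightarrow> 'a::comm_ring_1"
  assumes "L > 0" "f 0 = 0" "f L = 0"
  shows "(\<Sum>x\<in>{1..<L}. f x * (2 * g x - g (x - 1) - g (x + 1))) =
    (\<Sum>x\<in>{0..<L}. (f (x + 1) - f x) * (g (x + 1) - g x))"
proof -
  let ?h = "\<lambda>x. f x * (g x - g (x - 1))"
  have ins: "{0..<L} = insert 0 {1..<L}" using assms by auto
  have "(\<Sum>x\<in>{0..<L}. (f (x + 1) - f x) * (g (x + 1) - g x)) -
      (\<Sum>x\<in>{0..<L}. f x * (2 * g x - g (x - 1) - g (x + 1))) = (\<Sum>x\<in>{0..<L}. ?h (x + 1) - ?h x)"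
    unfolding sum_subtractf[symmetric] by (intro sum.cong) (simp_all add: algebra_simps)
  also have "\<dots> = ?h L - ?h 0" using assms by (intro sum_telescope_int) auto
  also have "\<dots> = 0" using assms by simp
  finally show ?thesis using assms by (simp add: ins)
qed

text \<open>At once the squared modulus of \<open>1 - cis t\<close>, the multiplier of the
  difference operator on the integers, and, at the angles \<open>j * pi / L\<close>, the eigenvalue
  of the Dirichlet Laplacian on the \<open>j\<close>-th sine vector.\<close>

definition lap_symbol :: "real \<Rightarrow> real" where
  "lap_symbol t = 2 - 2 * cos t"

text \<open>Two summations by parts move the second difference of \<open>u\<close> onto the sine
  row, where it is multiplication by the eigenvalue. Parseval for the sine transform then turns the
  energy into the weighted sum.\<close>

lemma dst_energy:
  assumes "L > 0" "u 0 = 0" "u L = 0"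
  shows "(\<Sum>x\<in>{0..<L}. (cmod (u (x + 1) - u x))\<^sup>2) =
    (\<Sum>j\<in>{1..<L}. lap_symbol (of_int j * pi / of_int L) * (cmod (dst L u j))\<^sup>2)"
proof -
  let ?K = "\<lambda>x. 2 * u x - u (x - 1) - u (x + 1)"
  have K: "dst L ?K j = of_real (lap_symbol (of_int j * pi / of_int L)) * dst L u j" for j
  proof -
    let ?s = "\<lambda>x. complex_of_real (dst_entry L j x)"
    have "dst L ?K j = (\<Sum>x\<in>{0..<L}. (?s (x + 1) - ?s x) * (u (x + 1) - u x))"
      unfolding dst_def using assms by (intro sum_by_parts_int) (simp_all add: dst_entry_0 dst_entry_L)
    also have "\<dots> = (\<Sum>x\<in>{0..<L}. (u (x + 1) - u x) * (?s (x + 1) - ?s x))"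
      by (simp add: mult.commute)
    also have "\<dots> = (\<Sum>x\<in>{1..<L}. u x * (2 * ?s x - ?s (x - 1) - ?s (x + 1)))"
      using assms by (intro sum_by_parts_int[symmetric])
    also have "\<dots> = (\<Sum>x\<in>{1..<L}. of_real (lap_symbol (of_int j * pi / of_int L)) * (?s x * u x))"
    proof (rule sum.cong[OF refl])
      fix x
      define y a where "y = of_int (j * x) * pi / real_of_int L" and "a = of_int j * pi / real_of_int L"
      have "of_int (j * (x - 1)) * pi / real_of_int L = y - a"
        "of_int (j * (x + 1)) * pi / real_of_int L = y + a"
        "of_int (j * x) * pi / real_of_int L = y"
        by (simp_all add: y_def a_def algebra_simps diff_divide_distrib add_divide_distrib)
      then have "2 * dst_entry L j x - dst_entry L j (x - 1) - dst_entry L j (x + 1) =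
          lap_symbol a * dst_entry L j x"
        by (simp only: dst_entry_def lap_symbol_def sin_add sin_diff) (simp add: algebra_simps)
      from this[THEN arg_cong, of complex_of_real]
      show "u x * (2 * ?s x - ?s (x - 1) - ?s (x + 1)) =
          of_real (lap_symbol (of_int j * pi / of_int L)) * (?s x * u x)"
        by (simp add: a_def)
    qed
    finally show ?thesis by (simp add: dst_def sum_distrib_left)
  qed
  have "complex_of_real (\<Sum>x\<in>{0..<L}. (cmod (u (x + 1) - u x))\<^sup>2) =
      (\<Sum>x\<in>{0..<L}. (cnj (u (x + 1)) - cnj (u x)) * (u (x + 1) - u x))"
    by (simp add: complex_norm_square mult.commute del: of_real_power)
  also have "\<dots> = (\<Sum>x\<in>{1..<L}. cnj (u x) * ?K x)"
    using assms by (intro sum_by_parts_int[symmetric]) auto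
  also have "\<dots> = (\<Sum>j\<in>{1..<L}. cnj (dst L u j) * dst L ?K j)"
    by (rule dst_parseval_inner[symmetric])
  also have "\<dots> = complex_of_real (\<Sum>j\<in>{1..<L}. lap_symbol (of_int j * pi / of_int L) * (cmod (dst L u j))\<^sup>2)"
    unfolding K by (simp add: complex_norm_square mult_ac del: of_real_power)
  finally show ?thesis using of_real_eq_iff by blast
qed

section \<open>Comparison of the resolvent forms\<close>

lemma lap_symbol_nonneg: "lap_symbol t \<ge> 0"
  by (simp add: lap_symbol_def)

lemma continuous_on_lap_symbol [continuous_intros]: "continuous_on A lap_symbol"
  unfolding lap_symbol_def by (intro continuous_intros)

lemma cmod_cis_diff_one: "(cmod (1 - cis t))\<^sup>2 = lap_symbol t"
  using sin_cos_squared_add[of t]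
  by (simp add: cmod_power2 lap_symbol_def power2_diff)

text \<open>Multiplication by \<open>1 - cis t\<close> takes backward differences of the
  coefficients, and Parseval applies to the result. Together with \<open>dst_energy\<close> this is
  the agreement of the two forms at \<open>p = 1\<close>.\<close>

lemma trig_energy:
  assumes "L > 0" "u 0 = 0" "u L = 0"
  shows "mean (\<lambda>t. lap_symbol t * (cmod (trig {1..<L} u t))\<^sup>2) =
    (\<Sum>x\<in>{0..<L}. (cmod (u (x + 1) - u x))\<^sup>2)"
proof -
  have "(1 - cis t) * trig {1..<L} u t = trig {1..L} (\<lambda>x. u x - u (x - 1)) t" for t
  proof -
    have *: "u i = 0" if "i < 1" "0 \<le> i" for i
    proof -
      have "i = 0" using that by linarith
      then show ?thesis using assms by simp
    qed
    have "trig {1..L} (\<lambda>x. u x - u (x - 1)) t =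
        (\<Sum>x\<in>{1..L}. u x * cis (x * t)) - (\<Sum>x\<in>{1..L}. u (x - 1) * cis (x * t))"
      by (simp add: trig_def left_diff_distrib sum_subtractf)
    also have "(\<Sum>x\<in>{1..L}. u (x - 1) * cis (x * t)) = (\<Sum>x\<in>{0..<L}. cis t * (u x * cis (x * t)))"
      by (rule sum.reindex_bij_witness[of _ "\<lambda>x. x + 1" "\<lambda>x. x - 1"])
        (auto simp: cis_mult algebra_simps)
    also have "(\<Sum>x\<in>{1..L}. u x * cis (x * t)) = trig {1..<L} u t"
      unfolding trig_def using assms by (intro sum.mono_neutral_right) (auto simp: not_less)
    also have "(\<Sum>x\<in>{0..<L}. cis t * (u x * cis (x * t))) = cis t * trig {1..<L} u t"
      unfolding trig_def sum_distrib_left using assms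
      by (intro sum.mono_neutral_right) (auto simp: not_le *)
    finally show ?thesis by (simp add: algebra_simps)
  qed
  note * = this
  have "mean (\<lambda>t. lap_symbol t * (cmod (trig {1..<L} u t))\<^sup>2) =
      mean (\<lambda>t. (cmod (trig {1..L} (\<lambda>x. u x - u (x - 1)) t))\<^sup>2)"
    by (intro mean_cong) (simp add: *[symmetric] norm_mult power_mult_distrib cmod_cis_diff_one)
  also have "\<dots> = (\<Sum>x\<in>{1..L}. (cmod (u x - u (x - 1)))\<^sup>2)"
    by (rule parseval_trig) simp
  also have "\<dots> = (\<Sum>x\<in>{0..<L}. (cmod (u (x + 1) - u x))\<^sup>2)"
    by (rule sum.reindex_bij_witness[of _ "\<lambda>x. x + 1" "\<lambda>x. x - 1"]) auto
  finally show ?thesis .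
qed

text \<open>The minimum over \<open>b\<close> of \<open>x \<bar>b\<bar>\<^sup>2 + l \<bar>a - b\<bar>\<^sup>2\<close> is the resolvent form \<open>l x / (x + l) \<bar>a\<bar>\<^sup>2\<close>.
  Trial functions built from the other side therefore compare the two resolvent forms.\<close>

lemma parallel_sum_le:
  assumes "x \<ge> 0" "l > 0"
  shows "l * (x / (x + l)) * (cmod a)\<^sup>2 \<le> x * (cmod b)\<^sup>2 + l * (cmod (a - b))\<^sup>2"
proof -
  have "(x + l) * (x * (cmod b)\<^sup>2 + l * (cmod (a - b))\<^sup>2) - l * x * (cmod a)\<^sup>2 =
      ((x + l) * Re b - l * Re a)\<^sup>2 + ((x + l) * Im b - l * Im a)\<^sup>2"
    unfolding cmod_power2 by (simp add: power2_eq_square algebra_simps)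
  then have "l * x * (cmod a)\<^sup>2 \<le> (x + l) * (x * (cmod b)\<^sup>2 + l * (cmod (a - b))\<^sup>2)"
    by (smt (verit) sum_power2_ge_zero)
  then show ?thesis
    using assms by (simp add: divide_le_eq mult_ac)
qed

text \<open>The minimiser depends on \<open>x\<close>, so the optimal splitting is made separately
  at each frequency of the side that is diagonal: the sine index in one comparison, the angle
  \<open>t\<close> in the other.\<close>

lemma parallel_sum_eq:
  assumes "x \<ge> 0" "l > 0" "b = of_real (l / (x + l)) * a"
  shows "x * (cmod b)\<^sup>2 + l * (cmod (a - b))\<^sup>2 = l * (x / (x + l)) * (cmod a)\<^sup>2"
proof -
  have "x + l \<noteq> 0" using assms by simp
  then have "x / (x + l) = 1 - l / (x + l)" by (simp add: field_simps)
  then have ab: "a - b = of_real (x / (x + l)) * a"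
    unfolding assms(3) by (simp add: left_diff_distrib)
  have "x * (cmod b)\<^sup>2 + l * (cmod (a - b))\<^sup>2 =
      (x * (l / (x + l))\<^sup>2 + l * (x / (x + l))\<^sup>2) * (cmod a)\<^sup>2"
    unfolding ab unfolding assms(3) norm_mult norm_of_real power_mult_distrib power2_abs
    by (simp only: distrib_right mult.assoc)
  also have "x * (l / (x + l))\<^sup>2 + l * (x / (x + l))\<^sup>2 = l * x * (x + l) / (x + l)\<^sup>2"
    by (simp add: power2_eq_square add_divide_distrib[symmetric] algebra_simps)
  also have "\<dots> = l * (x / (x + l))"
    using \<open>x + l \<noteq> 0\<close> by (simp add: power2_eq_square)
  finally show ?thesis .
qed

text \<open>The optimal splitting of the sine side serves as a trial splitting of the Toeplitz side.
  Norm and energy of a sequence supported in \<open>1..<L\<close> are the same on both sides, so no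
  constant is lost.\<close>

lemma trig_resolvent_le_dst:
  assumes "L > 0" "l > 0"
  shows "mean (\<lambda>t. lap_symbol t / (lap_symbol t + l) * (cmod (trig {1..<L} u t))\<^sup>2) \<le>
    (\<Sum>j\<in>{1..<L}. lap_symbol (of_int j * pi / of_int L) /
      (lap_symbol (of_int j * pi / of_int L) + l) * (cmod (dst L u j))\<^sup>2)"
proof -
  let ?m = "\<lambda>j. lap_symbol (of_int j * pi / of_int L)"
  have nz: "lap_symbol t + l \<noteq> 0" for t using lap_symbol_nonneg[of t] assms by linarith
  \<comment> \<open>These are the optimal sine coefficients; \<open>v\<close> is their inverse
    transform, set to zero outside \<open>1..<L\<close> so that both energy identities apply to
    it.\<close>
  define d where "d j = of_real (l / (?m j + l)) * dst L u j" for j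
  define v where "v x = (if x \<in> {1..<L} then dst L d x else 0)" for x
  have dst_v: "dst L v j = d j" if "j \<in> {1..<L}" for j
    using that dst_dst[of j L d] by (simp add: dst_def v_def)
  have "l * mean (\<lambda>t. lap_symbol t / (lap_symbol t + l) * (cmod (trig {1..<L} u t))\<^sup>2) =
      mean (\<lambda>t. l * (lap_symbol t / (lap_symbol t + l) * (cmod (trig {1..<L} u t))\<^sup>2))"
    using nz by (intro mean_cmult_right[symmetric] continuous_intros) auto
  also have "\<dots> \<le> mean (\<lambda>t. lap_symbol t * (cmod (trig {1..<L} v t))\<^sup>2 +
      l * (cmod (trig {1..<L} u t - trig {1..<L} v t))\<^sup>2)"
    using parallel_sum_le[OF lap_symbol_nonneg assms(2)] nz
    by (intro mean_mono continuous_intros) (auto simp: mult.assoc)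
  also have "\<dots> = mean (\<lambda>t. lap_symbol t * (cmod (trig {1..<L} v t))\<^sup>2) +
      l * mean (\<lambda>t. (cmod (trig {1..<L} (\<lambda>x. u x - v x) t))\<^sup>2)"
    by (subst mean_cmult_right[symmetric], (intro continuous_intros)?, subst mean_add[symmetric])
      (auto intro!: continuous_intros simp: trig_def sum_subtractf left_diff_distrib)
  also have "mean (\<lambda>t. lap_symbol t * (cmod (trig {1..<L} v t))\<^sup>2) =
      (\<Sum>j\<in>{1..<L}. ?m j * (cmod (dst L v j))\<^sup>2)"
  proof -
    have "v 0 = 0" "v L = 0" by (simp_all add: v_def)
    then show ?thesis using assms by (simp add: trig_energy dst_energy)
  qed
  also have "mean (\<lambda>t. (cmod (trig {1..<L} (\<lambda>x. u x - v x) t))\<^sup>2) =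
      (\<Sum>j\<in>{1..<L}. (cmod (dst L u j - dst L v j))\<^sup>2)"
    by (simp only: parseval_trig finite_atLeastLessThan_int dst_parseval flip: dst_diff)
  also have "(\<Sum>j\<in>{1..<L}. ?m j * (cmod (dst L v j))\<^sup>2) + l * (\<Sum>j\<in>{1..<L}. (cmod (dst L u j - dst L v j))\<^sup>2) =
      (\<Sum>j\<in>{1..<L}. ?m j * (cmod (dst L v j))\<^sup>2 + l * (cmod (dst L u j - dst L v j))\<^sup>2)"
    by (simp add: sum.distrib sum_distrib_left)
  also have "\<dots> = (\<Sum>j\<in>{1..<L}. l * (?m j / (?m j + l) * (cmod (dst L u j))\<^sup>2))"
    using parallel_sum_eq[OF lap_symbol_nonneg assms(2)]
    by (intro sum.cong) (auto simp: dst_v d_def mult.assoc)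
  also have "\<dots> = l * (\<Sum>j\<in>{1..<L}. ?m j / (?m j + l) * (cmod (dst L u j))\<^sup>2)"
    by (simp add: sum_distrib_left)
  finally show ?thesis using assms by simp
qed

text \<open>A shift of the index is multiplication by \<open>cis (- t)\<close>. The squared modulus
  of the resulting factor is \<open>lap_symbol t\<close>, which lets Bessel bound the energy of a
  coefficient sequence.\<close>

lemma coef_increment:
  assumes "continuous_on {-pi..pi} f"
  shows "coef f (x + 1) - coef f x = coef (\<lambda>t. f t * (cis (- t) - 1)) x"
proof -
  have "cis (- of_int (x + 1) * t) = cis (- t) * cis (- of_int x * t)" for t
    by (simp add: cis_mult algebra_simps)
  then show ?thesis
    unfolding coef_def using assms
    by (subst mean_diff[symmetric]) (auto intro!: continuous_intros mean_cong simp: algebra_simps)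
qed

text \<open>Now the optimal splitting \<open>g\<close> is made on the Toeplitz side. It is in
  general no trigonometric polynomial with frequencies in \<open>1..<L\<close>; reflecting its
  coefficients gives a trial sequence \<open>w\<close> that vanishes at both ends. Bessel is applied
  to \<open>T - g\<close> and to \<open>g\<close> times \<open>cis (- t) - 1\<close>, and the
  reflection costs the factor 20 in norm and in energy.\<close>

lemma dst_le_trig_resolvent:
  assumes "L > 0" "l > 0"
  shows "(\<Sum>j\<in>{1..<L}. lap_symbol (of_int j * pi / of_int L) /
      (lap_symbol (of_int j * pi / of_int L) + l) * (cmod (dst L u j))\<^sup>2) \<le>
    20 * mean (\<lambda>t. lap_symbol t / (lap_symbol t + l) * (cmod (trig {1..<L} u t))\<^sup>2)"
proof -
  let ?m = "\<lambda>j. lap_symbol (of_int j * pi / of_int L)"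
  have nz: "lap_symbol t + l \<noteq> 0" for t using lap_symbol_nonneg[of t] assms by linarith
  define T where "T = trig {1..<L} u"
  define g where "g t = of_real (l / (lap_symbol t + l)) * T t" for t
  have contT: "continuous_on {-pi..pi} T"
    unfolding T_def by (intro continuous_intros)
  have contg: "continuous_on {-pi..pi} g"
    unfolding g_def T_def using nz by (intro continuous_intros) auto
  define w where "w = reflect L (coef g)"
  have w0: "w 0 = 0" "w L = 0"
    using assms by (simp_all add: w_def reflect_0 reflect_L)
  have cT: "coef T x = (if x \<in> {1..<L} then u x else 0)" for x
    unfolding T_def by (simp add: coef_trig)
  have refl_u: "reflect L (coef T) x = u x" if "x \<in> {1..<L}" for x
    using that by (simp add: reflect_def cT)
  \<comment> \<open>The retraction fixes \<open>u\<close> on \<open>1..<L\<close>, so by linearity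
    the error \<open>u - w\<close> is itself a reflection, namely of the coefficients of
    \<open>T - g\<close>.\<close>
  have uw: "u x - w x = reflect L (coef (\<lambda>t. T t - g t)) x" if "x \<in> {1..<L}" for x
  proof -
    have "coef (\<lambda>t. T t - g t) = (\<lambda>x. coef T x - coef g x)"
      using coef_diff[OF contT contg] by auto
    then show ?thesis
      unfolding w_def using refl_u[OF that] by (simp add: reflect_diff)
  qed
  have energy: "(\<Sum>x\<in>{0..<L}. (cmod (w (x + 1) - w x))\<^sup>2) \<le> 20 * mean (\<lambda>t. lap_symbol t * (cmod (g t))\<^sup>2)"
  proof -
    have "(\<Sum>x\<in>{0..<L}. (cmod (w (x + 1) - w x))\<^sup>2) \<le>
        20 * (\<Sum>y\<in>{-L..<2*L}. (cmod (coef g (y + 1) - coef g y))\<^sup>2)"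
      unfolding w_def by (rule reflect_energy[OF assms(1)])
    also have "(\<Sum>y\<in>{-L..<2*L}. (cmod (coef g (y + 1) - coef g y))\<^sup>2) \<le>
        mean (\<lambda>t. (cmod (g t * (cis (- t) - 1)))\<^sup>2)"
      unfolding coef_increment[OF contg]
      using contg by (intro bessel continuous_intros) (auto simp: cis_conv_exp intro!: continuous_intros)
    also have "\<dots> = mean (\<lambda>t. lap_symbol t * (cmod (g t))\<^sup>2)"
    proof (rule mean_cong)
      fix t
      have "(cmod (cis (- t) - 1))\<^sup>2 = lap_symbol t"
        using cmod_cis_diff_one[of "- t"] by (simp add: norm_minus_commute lap_symbol_def)
      then show "(cmod (g t * (cis (- t) - 1)))\<^sup>2 = lap_symbol t * (cmod (g t))\<^sup>2"
        by (simp add: norm_mult power_mult_distrib mult.commute)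
    qed
    finally show ?thesis by simp
  qed
  have l2: "(\<Sum>x\<in>{1..<L}. (cmod (u x - w x))\<^sup>2) \<le> 20 * mean (\<lambda>t. (cmod (T t - g t))\<^sup>2)"
  proof -
    have "(\<Sum>x\<in>{1..<L}. (cmod (u x - w x))\<^sup>2) =
        (\<Sum>x\<in>{1..<L}. (cmod (reflect L (coef (\<lambda>t. T t - g t)) x))\<^sup>2)"
      by (intro sum.cong) (simp_all add: uw)
    also have "\<dots> \<le> 20 * (\<Sum>x\<in>{-L..2*L}. (cmod (coef (\<lambda>t. T t - g t) x))\<^sup>2)"
      by (rule reflect_l2[OF assms(1)])
    also have "(\<Sum>x\<in>{-L..2*L}. (cmod (coef (\<lambda>t. T t - g t) x))\<^sup>2) \<le> mean (\<lambda>t. (cmod (T t - g t))\<^sup>2)"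
      using contT contg by (intro bessel continuous_intros) auto
    finally show ?thesis by simp
  qed
  have "l * (\<Sum>j\<in>{1..<L}. ?m j / (?m j + l) * (cmod (dst L u j))\<^sup>2) =
      (\<Sum>j\<in>{1..<L}. l * (?m j / (?m j + l)) * (cmod (dst L u j))\<^sup>2)"
    by (simp add: sum_distrib_left mult.assoc)
  also have "\<dots> \<le> (\<Sum>j\<in>{1..<L}. ?m j * (cmod (dst L w j))\<^sup>2 + l * (cmod (dst L u j - dst L w j))\<^sup>2)"
    using assms by (intro sum_mono parallel_sum_le lap_symbol_nonneg)
  also have "\<dots> = (\<Sum>j\<in>{1..<L}. ?m j * (cmod (dst L w j))\<^sup>2) +
      l * (\<Sum>j\<in>{1..<L}. (cmod (dst L (\<lambda>x. u x - w x) j))\<^sup>2)"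
    by (simp add: sum.distrib sum_distrib_left dst_diff)
  also have "\<dots> = (\<Sum>x\<in>{0..<L}. (cmod (w (x + 1) - w x))\<^sup>2) + l * (\<Sum>x\<in>{1..<L}. (cmod (u x - w x))\<^sup>2)"
    unfolding dst_parseval using assms w0 by (simp add: dst_energy)
  also have "\<dots> \<le> 20 * mean (\<lambda>t. lap_symbol t * (cmod (g t))\<^sup>2) + l * (20 * mean (\<lambda>t. (cmod (T t - g t))\<^sup>2))"
    using energy l2 assms by (intro add_mono mult_left_mono) auto
  also have "\<dots> = 20 * (mean (\<lambda>t. lap_symbol t * (cmod (g t))\<^sup>2) + mean (\<lambda>t. l * (cmod (T t - g t))\<^sup>2))"
    using contT contg by (subst mean_cmult_right) (auto intro!: continuous_intros)
  also have "mean (\<lambda>t. lap_symbol t * (cmod (g t))\<^sup>2) + mean (\<lambda>t. l * (cmod (T t - g t))\<^sup>2) =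
      mean (\<lambda>t. lap_symbol t * (cmod (g t))\<^sup>2 + l * (cmod (T t - g t))\<^sup>2)"
    using contT contg by (intro mean_add[symmetric] continuous_intros)
  also have "\<dots> = mean (\<lambda>t. l * (lap_symbol t / (lap_symbol t + l) * (cmod (T t))\<^sup>2))"
    using parallel_sum_eq[OF lap_symbol_nonneg assms(2) g_def]
    by (intro mean_cong) (simp add: mult.assoc)
  also have "\<dots> = l * mean (\<lambda>t. lap_symbol t / (lap_symbol t + l) * (cmod (T t))\<^sup>2)"
    using contT nz by (intro mean_cmult_right continuous_intros) auto
  finally have "l * (\<Sum>j\<in>{1..<L}. ?m j / (?m j + l) * (cmod (dst L u j))\<^sup>2) \<le>
      l * (20 * mean (\<lambda>t. lap_symbol t / (lap_symbol t + l) * (cmod (T t))\<^sup>2))"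
    by (simp add: mult.left_commute)
  then show ?thesis using assms unfolding T_def by simp
qed

section \<open>Interpolation to fractional powers\<close>

text \<open>The value is \<open>\<pi> / sin (\<pi> p)\<close>; only its being positive and finite matters, so that it cancels.\<close>

definition stieltjes_const :: "real \<Rightarrow> ennreal" where
  "stieltjes_const p = (\<integral>\<^sup>+ l. ennreal (indicator {0<..} l * (l powr (p - 1) * (1 / (1 + l)))) \<partial>lborel)"

text \<open>Rescaling \<open>l\<close> by the factor \<open>x\<close> reduces the integral to the
  case \<open>x = 1\<close>. In \<open>ennreal\<close> the identity makes sense before the integral
  is known to be finite.\<close>

lemma nn_integral_stieltjes:
  assumes "0 < p" "x \<ge> 0"
  shows "(\<integral>\<^sup>+ l. ennreal (indicator {0<..} l * (l powr (p - 1) * (x / (x + l)))) \<partial>lborel) =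
    stieltjes_const p * ennreal (x powr p)"
proof (cases "x = 0")
  case False
  with assms have x: "x > 0" by simp
  have "(\<integral>\<^sup>+ l. ennreal (indicator {0<..} l * (l powr (p - 1) * (x / (x + l)))) \<partial>lborel) =
     ennreal \<bar>x\<bar> * (\<integral>\<^sup>+ l. ennreal (indicator {0<..} (0 + x * l) *
       ((0 + x * l) powr (p - 1) * (x / (x + (0 + x * l))))) \<partial>lborel)"
    using x by (intro nn_integral_real_affine) measurable
  also have "(\<lambda>l. ennreal (indicator {0<..} (0 + x * l) *
       ((0 + x * l) powr (p - 1) * (x / (x + (0 + x * l)))))) =
     (\<lambda>l. ennreal (x powr (p - 1)) * ennreal (indicator {0<..} l * (l powr (p - 1) * (1 / (1 + l)))))"
  proof
    fix l :: real
    show "ennreal (indicator {0<..} (0 + x * l) * ((0 + x * l) powr (p - 1) * (x / (x + (0 + x * l))))) =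
      ennreal (x powr (p - 1)) * ennreal (indicator {0<..} l * (l powr (p - 1) * (1 / (1 + l))))"
    proof (cases "l > 0")
      case True
      have "x + x * l > 0" using x True by (simp add: add_pos_pos)
      then have "x / (x + x * l) = 1 / (1 + l)"
        using x True by (simp add: field_simps)
      then have "indicator {0<..} (0 + x * l) * ((0 + x * l) powr (p - 1) * (x / (x + (0 + x * l)))) =
          x powr (p - 1) * (indicator {0<..} l * (l powr (p - 1) * (1 / (1 + l))))"
        using x True by (simp add: powr_mult)
      then show ?thesis by (simp only: ennreal_mult'[OF powr_ge_zero])
    qed (use x in \<open>simp add: zero_less_mult_iff\<close>)
  qed
  also have "(\<integral>\<^sup>+ l. ennreal (x powr (p - 1)) *
      ennreal (indicator {0<..} l * (l powr (p - 1) * (1 / (1 + l)))) \<partial>lborel) =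
      ennreal (x powr (p - 1)) * stieltjes_const p"
    unfolding stieltjes_const_def by (intro nn_integral_cmult) measurable
  also have "ennreal \<bar>x\<bar> * (ennreal (x powr (p - 1)) * stieltjes_const p) =
      stieltjes_const p * ennreal (\<bar>x\<bar> * x powr (p - 1))"
    by (simp add: ennreal_mult' mult_ac)
  also have "\<bar>x\<bar> * x powr (p - 1) = x powr p"
    using x powr_mult_base[of x "p - 1"] by simp
  finally show ?thesis .
qed simp

text \<open>Near 0 the integrand is at most \<open>l powr (p - 1)\<close>, integrable because
  \<open>p > 0\<close>; beyond 1 it is at most \<open>l powr (p - 2)\<close>, integrable because
  \<open>p < 1\<close>.\<close>

lemma stieltjes_const_finite:
  assumes "0 < p" "p < 1"
  shows "stieltjes_const p \<noteq> \<infinity>"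
proof -
  have "stieltjes_const p \<le> (\<integral>\<^sup>+ l. ennreal (indicator {0..1} l * l powr (p - 1)) +
      ennreal (indicator {1..} l * l powr (p - 2)) \<partial>lborel)"
    unfolding stieltjes_const_def
  proof (rule nn_integral_mono)
    fix l :: real
    have "l powr (p - 1) * (1 / (1 + l)) \<le> l powr (p - 1)" if "l > 0"
      using that by (intro mult_left_le) auto
    moreover have "l powr (p - 1) * (1 / (1 + l)) \<le> l powr (p - 2)" if "l > 0"
    proof -
      have "l powr (p - 1) * (1 / (1 + l)) \<le> l powr (p - 1) * (1 / l)"
        using that by (intro mult_left_mono divide_left_mono) auto
      also have "\<dots> = l powr (p - 2)"
        using that powr_mult_base[of l "p - 2"] by (simp add: field_simps)
      finally show ?thesis .
    qed
    ultimately have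
      "indicator {0<..} l * (l powr (p - 1) * (1 / (1 + l))) \<le>
        indicator {0..1} l * l powr (p - 1) + indicator {1..} l * l powr (p - 2)"
      by (auto simp: indicator_def intro: add_increasing)
    then show "ennreal (indicator {0<..} l * (l powr (p - 1) * (1 / (1 + l)))) \<le>
        ennreal (indicator {0..1} l * l powr (p - 1)) + ennreal (indicator {1..} l * l powr (p - 2))"
      by (simp add: ennreal_leI flip: ennreal_plus)
  qed
  also have "\<dots> = (\<integral>\<^sup>+ l. ennreal (indicator {0..1} l * l powr (p - 1)) \<partial>lborel) +
      (\<integral>\<^sup>+ l. ennreal (indicator {1..} l * l powr (p - 2)) \<partial>lborel)"
    by (intro nn_integral_add) measurable
  also have "(\<integral>\<^sup>+ l. ennreal (indicator {0..1} l * l powr (p - 1)) \<partial>lborel) =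
      ennreal (1 powr (p - 1 + 1) / (p - 1 + 1))"
    using assms by (intro nn_integral_has_integral_lebesgue has_integral_powr_from_0) auto
  also have "(\<integral>\<^sup>+ l. ennreal (indicator {1..} l * l powr (p - 2)) \<partial>lborel) =
      ennreal (- (1 powr (p - 2 + 1)) / (p - 2 + 1))"
    using assms by (intro nn_integral_has_integral_lebesgue has_integral_powr_to_inf) auto
  finally show ?thesis
    by (auto simp: top_unique)
qed

lemma stieltjes_const_nonzero:
  assumes "0 < p"
  shows "stieltjes_const p \<noteq> 0"
proof -
  have "(\<integral>\<^sup>+ l. ennreal (1 / 6) * indicator {1..2::real} l \<partial>lborel) \<le> stieltjes_const p"
    unfolding stieltjes_const_def
  proof (rule nn_integral_mono)
    fix l :: real
    \<comment> \<open>On the interval from 1 to 2 the power is at least 1/2 and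
      \<open>1 / (1 + l)\<close> at least 1/3.\<close>
    have "1 / 6 \<le> l powr (p - 1) * (1 / (1 + l))" if "1 \<le> l" "l \<le> 2"
    proof -
      have "1 / 2 \<le> l powr (- 1)" using that by (simp add: powr_minus field_simps)
      also have "\<dots> \<le> l powr (p - 1)" using that assms by (intro powr_mono) auto
      finally have "1 / 2 * (1 / 3) \<le> l powr (p - 1) * (1 / (1 + l))"
        using that by (intro mult_mono) (auto simp: field_simps)
      then show ?thesis by simp
    qed
    then show "ennreal (1 / 6) * indicator {1..2} l \<le>
        ennreal (indicator {0<..} l * (l powr (p - 1) * (1 / (1 + l))))"
      by (auto simp: indicator_def intro!: ennreal_leI)
  qed
  moreover have "(\<integral>\<^sup>+ l. ennreal (1 / 6) * indicator {1..2::real} l \<partial>lborel) = ennreal (1 / 6)"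
    by (subst nn_integral_cmult_indicator) auto
  ultimately show ?thesis by auto
qed

section \<open>From resolvents to powers by exchanging the order of integration\<close>

lemma mean_nonneg:
  assumes "continuous_on UNIV f" "\<And>t. f t \<ge> (0::real)"
  shows "mean f \<ge> 0"
  unfolding mean_def using assms continuous_on_subset[of UNIV f]
  by (auto intro!: divide_nonneg_nonneg integral_nonneg integrable_continuous_interval)

lemma ennreal_mean:
  assumes "continuous_on UNIV f" "\<And>t. f t \<ge> 0"
  shows "ennreal (mean f) = ennreal (1 / (2 * pi)) * (\<integral>\<^sup>+ t. ennreal (indicator {-pi..pi} t * f t) \<partial>lborel)"
proof -
  have "continuous_on {-pi..pi} f" using assms(1) continuous_on_subset by blast
  then have "(f has_integral integral {-pi..pi} f) {-pi..pi}"
    using integrable_continuous_interval integrable_integral by blast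
  with assms(2) have "(\<integral>\<^sup>+ t. ennreal (indicator {-pi..pi} t * f t) \<partial>lborel) = ennreal (integral {-pi..pi} f)"
    by (intro nn_integral_has_integral_lebesgue) auto
  then show ?thesis
    by (simp add: mean_def ennreal_mult'[symmetric])
qed

text \<open>By Tonelli the integral over \<open>l\<close> moves inside the mean, where it reproduces
  the power pointwise in \<open>t\<close>. The weight \<open>g\<close> stands for the squared
  modulus of a trigonometric polynomial.\<close>

lemma nn_integral_mean_resolvent:
  fixes m g :: "real \<Rightarrow> real"
  assumes m: "continuous_on UNIV m" "\<And>t. m t \<ge> 0" and g: "continuous_on UNIV g" "\<And>t. g t \<ge> 0"
    and p: "0 < p"
  shows "(\<integral>\<^sup>+ l. ennreal (indicator {0<..} l * (l powr (p - 1) * mean (\<lambda>t. m t / (m t + l) * g t))) \<partial>lborel) =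
    stieltjes_const p * ennreal (mean (\<lambda>t. m t powr p * g t))"
proof -
  have [measurable]: "m \<in> borel_measurable borel" "g \<in> borel_measurable borel"
    using m(1) g(1) by (simp_all add: borel_measurable_continuous_onI)
  define F where "F l t = indicator {-pi..pi} t * (indicator {0<..} l * (l powr (p - 1) * (m t / (m t + l) * g t)))"
    for l t :: real
  have F_meas: "case_prod (\<lambda>l t. ennreal (F l t)) \<in> borel_measurable (lborel \<Otimes>\<^sub>M lborel)"
    unfolding F_def by measurable
  have [measurable]: "(\<lambda>t. ennreal (F l t)) \<in> borel_measurable lborel" for l
    unfolding F_def by measurable
  have "(\<integral>\<^sup>+ l. ennreal (indicator {0<..} l * (l powr (p - 1) * mean (\<lambda>t. m t / (m t + l) * g t))) \<partial>lborel) =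
      (\<integral>\<^sup>+ l. ennreal (1 / (2 * pi)) * (\<integral>\<^sup>+ t. ennreal (F l t) \<partial>lborel) \<partial>lborel)"
  proof (rule nn_integral_cong)
    fix l :: real
    show "ennreal (indicator {0<..} l * (l powr (p - 1) * mean (\<lambda>t. m t / (m t + l) * g t))) =
        ennreal (1 / (2 * pi)) * (\<integral>\<^sup>+ t. ennreal (F l t) \<partial>lborel)"
    proof (cases "l > 0")
      case True
      have "m t + l \<noteq> 0" for t using m(2)[of t] True by linarith
      then have cont: "continuous_on A (\<lambda>t. m t / (m t + l) * g t)" for A
        using m(1) g(1) by (intro continuous_intros) (auto intro: continuous_on_subset)
      have "ennreal (mean (\<lambda>t. l powr (p - 1) * (m t / (m t + l) * g t))) =
          ennreal (1 / (2 * pi)) *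
          (\<integral>\<^sup>+ t. ennreal (indicator {-pi..pi} t * (l powr (p - 1) * (m t / (m t + l) * g t))) \<partial>lborel)"
        using m(2) g(2) True
        by (intro ennreal_mean continuous_on_mult continuous_on_const cont) (simp_all add: add_nonneg_pos)
      then show ?thesis
        using True mean_cmult_right[OF cont] by (simp add: F_def)
    qed (simp add: F_def)
  qed
  also have "\<dots> = ennreal (1 / (2 * pi)) * (\<integral>\<^sup>+ l. (\<integral>\<^sup>+ t. ennreal (F l t) \<partial>lborel) \<partial>lborel)"
    by (intro nn_integral_cmult lborel.borel_measurable_nn_integral F_meas)
  also have "(\<integral>\<^sup>+ l. (\<integral>\<^sup>+ t. ennreal (F l t) \<partial>lborel) \<partial>lborel) =
      (\<integral>\<^sup>+ t. (\<integral>\<^sup>+ l. ennreal (F l t) \<partial>lborel) \<partial>lborel)"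
    by (rule lborel_pair.Fubini'[OF F_meas, symmetric])
  also have "\<dots> = (\<integral>\<^sup>+ t. stieltjes_const p * ennreal (indicator {-pi..pi} t * (m t powr p * g t)) \<partial>lborel)"
  proof (rule nn_integral_cong)
    fix t :: real
    have "ennreal (F l t) = ennreal (indicator {-pi..pi} t * g t) *
        ennreal (indicator {0<..} l * (l powr (p - 1) * (m t / (m t + l))))" for l
      unfolding F_def using g(2)[of t] by (simp add: ennreal_mult'[symmetric] mult_ac)
    then have "(\<integral>\<^sup>+ l. ennreal (F l t) \<partial>lborel) = ennreal (indicator {-pi..pi} t * g t) *
        (stieltjes_const p * ennreal (m t powr p))"
      using nn_integral_stieltjes[OF p m(2), of t] by (simp add: nn_integral_cmult)
    also have "\<dots> = stieltjes_const p * ennreal (indicator {-pi..pi} t * (m t powr p * g t))"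
      using g(2)[of t] by (simp add: ennreal_mult'[symmetric] mult_ac)
    finally show "(\<integral>\<^sup>+ l. ennreal (F l t) \<partial>lborel) =
        stieltjes_const p * ennreal (indicator {-pi..pi} t * (m t powr p * g t))" .
  qed
  also have "\<dots> = stieltjes_const p * (\<integral>\<^sup>+ t. ennreal (indicator {-pi..pi} t * (m t powr p * g t)) \<partial>lborel)"
    by (intro nn_integral_cmult) measurable
  also have "ennreal (1 / (2 * pi)) * (stieltjes_const p *
      (\<integral>\<^sup>+ t. ennreal (indicator {-pi..pi} t * (m t powr p * g t)) \<partial>lborel)) =
      stieltjes_const p * ennreal (mean (\<lambda>t. m t powr p * g t))"
    using m g p by (subst ennreal_mean) (auto intro!: continuous_intros continuous_on_powr' simp: mult.left_commute)
  finally show ?thesis .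
qed

lemma nn_integral_sum_resolvent:
  fixes a \<mu> :: "'j \<Rightarrow> real"
  assumes "finite J" "\<And>j. a j \<ge> 0" "\<And>j. \<mu> j \<ge> 0" "0 < p"
  shows "(\<integral>\<^sup>+ l. ennreal (indicator {0<..} l * (l powr (p - 1) * (\<Sum>j\<in>J. \<mu> j / (\<mu> j + l) * a j))) \<partial>lborel) =
    stieltjes_const p * ennreal (\<Sum>j\<in>J. \<mu> j powr p * a j)"
proof -
  let ?k = "\<lambda>j l. indicator {0<..} l * (l powr (p - 1) * (\<mu> j / (\<mu> j + l)))"
  have k: "?k j l \<ge> 0" for j l
    using assms(3)[of j] by (cases "l > 0") auto
  have "(\<integral>\<^sup>+ l. ennreal (indicator {0<..} l * (l powr (p - 1) * (\<Sum>j\<in>J. \<mu> j / (\<mu> j + l) * a j))) \<partial>lborel) =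
      (\<integral>\<^sup>+ l. (\<Sum>j\<in>J. ennreal (a j) * ennreal (?k j l)) \<partial>lborel)"
  proof (rule nn_integral_cong)
    fix l :: real
    have "indicator {0<..} l * (l powr (p - 1) * (\<Sum>j\<in>J. \<mu> j / (\<mu> j + l) * a j)) =
        (\<Sum>j\<in>J. a j * ?k j l)"
      by (simp add: sum_distrib_left mult_ac)
    then show "ennreal (indicator {0<..} l * (l powr (p - 1) * (\<Sum>j\<in>J. \<mu> j / (\<mu> j + l) * a j))) =
        (\<Sum>j\<in>J. ennreal (a j) * ennreal (?k j l))"
      using assms(2) k by (simp only: ennreal_mult'[symmetric] sum_ennreal mult_nonneg_nonneg)
  qed
  also have "\<dots> = (\<Sum>j\<in>J. ennreal (a j) * (\<integral>\<^sup>+ l. ennreal (?k j l) \<partial>lborel))"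
    by (subst nn_integral_sum) (auto intro!: sum.cong nn_integral_cmult)
  also have "\<dots> = (\<Sum>j\<in>J. stieltjes_const p * ennreal (\<mu> j powr p * a j))"
    using assms by (simp only: nn_integral_stieltjes ennreal_mult' powr_ge_zero mult_ac)
  also have "\<dots> = stieltjes_const p * ennreal (\<Sum>j\<in>J. \<mu> j powr p * a j)"
    using assms by (simp flip: sum_distrib_left)
  finally show ?thesis .
qed

text \<open>Cancelling in \<open>ennreal\<close> requires a factor that is neither 0 nor infinite;
  \<open>y \<ge> 0\<close> is there because \<open>ennreal\<close> sends negative numbers to
  0.\<close>

lemma stieltjes_const_mult_le_cancel:
  assumes "0 < p" "p < 1" "stieltjes_const p * ennreal x \<le> stieltjes_const p * ennreal y" "y \<ge> 0"
  shows "x \<le> y"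
  using assms stieltjes_const_finite[of p] stieltjes_const_nonzero[of p]
  by (auto simp: ennreal_mult_le_mult_iff top_unique)

context
  fixes m g :: "real \<Rightarrow> real" and a \<mu> :: "'j \<Rightarrow> real" and J :: "'j set" and p :: real
  assumes m: "continuous_on UNIV m" "\<And>t. m t \<ge> 0" and g: "continuous_on UNIV g" "\<And>t. g t \<ge> 0"
    and J: "finite J" "\<And>j. a j \<ge> 0" "\<And>j. \<mu> j \<ge> 0" and p: "0 < p" "p < 1"
begin

text \<open>The resolvent inequality is integrated against the positive weight
  \<open>l powr (p - 1)\<close>; the constant common to both sides then cancels.\<close>

lemma mean_powr_le_sum:
  assumes "\<And>l. l > 0 \<Longrightarrow> mean (\<lambda>t. m t / (m t + l) * g t) \<le> (\<Sum>j\<in>J. \<mu> j / (\<mu> j + l) * a j)"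
  shows "mean (\<lambda>t. m t powr p * g t) \<le> (\<Sum>j\<in>J. \<mu> j powr p * a j)"
proof (rule stieltjes_const_mult_le_cancel[OF p])
  show "stieltjes_const p * ennreal (mean (\<lambda>t. m t powr p * g t)) \<le>
      stieltjes_const p * ennreal (\<Sum>j\<in>J. \<mu> j powr p * a j)"
    unfolding nn_integral_mean_resolvent[OF m g p(1), symmetric]
      nn_integral_sum_resolvent[OF J p(1), symmetric]
  proof (intro nn_integral_mono ennreal_leI)
    fix l :: real
    show "indicator {0<..} l * (l powr (p - 1) * mean (\<lambda>t. m t / (m t + l) * g t)) \<le>
        indicator {0<..} l * (l powr (p - 1) * (\<Sum>j\<in>J. \<mu> j / (\<mu> j + l) * a j))"
      using assms[of l]
      by (cases "l > 0") (auto intro!: mult_left_mono simp del: times_divide_eq_left times_divide_eq_right)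
  qed
qed (intro sum_nonneg mult_nonneg_nonneg powr_ge_zero J)

lemma sum_le_mean_powr:
  assumes "\<And>l. l > 0 \<Longrightarrow> (\<Sum>j\<in>J. \<mu> j / (\<mu> j + l) * a j) \<le> K * mean (\<lambda>t. m t / (m t + l) * g t)"
    and K: "K \<ge> 0"
  shows "(\<Sum>j\<in>J. \<mu> j powr p * a j) \<le> K * mean (\<lambda>t. m t powr p * g t)"
proof (rule stieltjes_const_mult_le_cancel[OF p])
  \<comment> \<open>The factor \<open>K\<close> is moved into the weight, so that the integral
    identity can be applied to \<open>K * g\<close>.\<close>
  have "stieltjes_const p * ennreal (\<Sum>j\<in>J. \<mu> j powr p * a j) \<le>
      (\<integral>\<^sup>+ l. ennreal (indicator {0<..} l * (l powr (p - 1) * mean (\<lambda>t. m t / (m t + l) * (K * g t)))) \<partial>lborel)"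
    unfolding nn_integral_sum_resolvent[OF J p(1), symmetric]
  proof (intro nn_integral_mono ennreal_leI)
    fix l :: real
    have "mean (\<lambda>t. m t / (m t + l) * (K * g t)) = K * mean (\<lambda>t. m t / (m t + l) * g t)" if "l > 0"
    proof -
      have "m t + l \<noteq> 0" for t using m(2)[of t] that by linarith
      then have "continuous_on {-pi..pi} (\<lambda>t. m t / (m t + l) * g t)"
        using m(1) g(1) by (intro continuous_intros) (auto intro: continuous_on_subset)
      from mean_cmult_right[OF this, of K] show ?thesis by (simp add: mult.left_commute)
    qed
    then show "indicator {0<..} l * (l powr (p - 1) * (\<Sum>j\<in>J. \<mu> j / (\<mu> j + l) * a j)) \<le>
        indicator {0<..} l * (l powr (p - 1) * mean (\<lambda>t. m t / (m t + l) * (K * g t)))"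
      using assms(1)[of l]
      by (cases "l > 0") (auto intro!: mult_left_mono simp del: times_divide_eq_left times_divide_eq_right)
  qed
  also have "\<dots> = stieltjes_const p * ennreal (mean (\<lambda>t. m t powr p * (K * g t)))"
    using m g p K by (intro nn_integral_mean_resolvent) (auto intro!: continuous_intros)
  also have "mean (\<lambda>t. m t powr p * (K * g t)) = K * mean (\<lambda>t. m t powr p * g t)"
  proof -
    have "continuous_on {-pi..pi} (\<lambda>t. m t powr p * g t)"
      using m g p by (intro continuous_intros continuous_on_powr') (auto intro: continuous_on_subset)
    from mean_cmult_right[OF this, of K] show ?thesis by (simp add: mult.left_commute)
  qed
  finally show "stieltjes_const p * ennreal (\<Sum>j\<in>J. \<mu> j powr p * a j) \<le>
      stieltjes_const p * ennreal (K * mean (\<lambda>t. m t powr p * g t))" .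
  show "0 \<le> K * mean (\<lambda>t. m t powr p * g t)"
    using m g p K by (intro mult_nonneg_nonneg mean_nonneg continuous_intros continuous_on_powr') auto
qed

end

lemma trig_powr_le_dst:
  assumes "L > 0" "0 < p" "p < 1"
  shows "mean (\<lambda>t. lap_symbol t powr p * (cmod (trig {1..<L} u t))\<^sup>2) \<le>
    (\<Sum>j\<in>{1..<L}. lap_symbol (of_int j * pi / of_int L) powr p * (cmod (dst L u j))\<^sup>2)"
  using assms trig_resolvent_le_dst
  by (intro mean_powr_le_sum) (auto intro!: continuous_intros lap_symbol_nonneg)

lemma dst_le_trig_powr:
  assumes "L > 0" "0 < p" "p < 1"
  shows "(\<Sum>j\<in>{1..<L}. lap_symbol (of_int j * pi / of_int L) powr p * (cmod (dst L u j))\<^sup>2) \<le>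
    20 * mean (\<lambda>t. lap_symbol t powr p * (cmod (trig {1..<L} u t))\<^sup>2)"
  using assms dst_le_trig_resolvent
  by (intro sum_le_mean_powr) (auto intro!: continuous_intros lap_symbol_nonneg)

section \<open>Bounds for the symbols and their forms\<close>

text \<open>With \<open>\<phi> = (\<pi> - \<bar>t\<bar>) / 2\<close> one has \<open>1 - exp (\<i> \<bar>t\<bar>) = 2 sin (\<bar>t\<bar> / 2) exp (- \<i> \<phi>)\<close>, which turns the
  symbol into \<open>(2 sin (\<bar>t\<bar> / 2)) powr \<gamma>\<close> times the following factor.\<close>

definition q_factor :: "real \<Rightarrow> real \<Rightarrow> real" where
  "q_factor \<gamma> t = \<gamma> * cos ((2 - \<gamma>) * ((pi - \<bar>t\<bar>) / 2)) - (2 - \<gamma>) * cos (\<gamma> * ((pi - \<bar>t\<bar>) / 2))"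

definition q_real :: "real \<Rightarrow> real \<Rightarrow> real" where
  "q_real \<gamma> t = lap_symbol t powr (\<gamma> / 2) * q_factor \<gamma> t"

text \<open>A lower bound for \<open>q_factor\<close>: \<open>cos (\<gamma> * \<phi>)\<close> is
  replaced by the larger \<open>cos ((2 - \<gamma>) * \<phi>)\<close>, then \<open>\<phi>\<close> by
  its maximum \<open>pi / 2\<close>. Both factors vanish at order 1, where the bound
  degenerates.\<close>

definition q_lower :: "real \<Rightarrow> real" where
  "q_lower \<gamma> = (2 * \<gamma> - 2) * cos ((2 - \<gamma>) * (pi / 2))"

lemma q_lower_pos:
  assumes "1 < \<gamma>" "\<gamma> < 2"
  shows "q_lower \<gamma> > 0"
proof -
  have "(2 - \<gamma>) * (pi / 2) < 1 * (pi / 2)"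
    using assms by (intro mult_strict_right_mono) auto
  moreover have "(2 - \<gamma>) * (pi / 2) > 0" using assms by simp
  ultimately have "cos ((2 - \<gamma>) * (pi / 2)) > 0"
    by (intro cos_gt_zero) auto
  then show ?thesis using assms by (simp add: q_lower_def)
qed

text \<open>The angles satisfy \<open>0 \<le> (2 - \<gamma>) * \<phi> \<le> \<gamma> * \<phi> \<le>
  pi\<close>, a range on which the cosine decreases. The upper bound is the sum of the two weights
  \<open>\<gamma>\<close> and \<open>2 - \<gamma>\<close>.\<close>

lemma q_factor_bounds:
  assumes "1 < \<gamma>" "\<gamma> < 2" "t \<in> {-pi..pi}"
  shows "q_lower \<gamma> \<le> q_factor \<gamma> t" "q_factor \<gamma> t \<le> 2"
proof -
  define \<phi> where "\<phi> = (pi - \<bar>t\<bar>) / 2"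
  have \<phi>: "0 \<le> \<phi>" "\<phi> \<le> pi / 2" using assms by (auto simp: \<phi>_def)
  have g: "0 \<le> (2 - \<gamma>) * \<phi>" "(2 - \<gamma>) * \<phi> \<le> \<gamma> * \<phi>" "\<gamma> * \<phi> \<le> pi"
    "(2 - \<gamma>) * \<phi> \<le> (2 - \<gamma>) * (pi / 2)"
    "(2 - \<gamma>) * (pi / 2) \<le> pi"
  proof -
    show "0 \<le> (2 - \<gamma>) * \<phi>" using assms \<phi> by simp
    show "(2 - \<gamma>) * \<phi> \<le> \<gamma> * \<phi>" using assms \<phi> by (intro mult_right_mono) auto
    have "\<gamma> * \<phi> \<le> 2 * (pi / 2)" using assms \<phi> by (intro mult_mono) auto
    then show "\<gamma> * \<phi> \<le> pi" by simp
    show "(2 - \<gamma>) * \<phi> \<le> (2 - \<gamma>) * (pi / 2)" using assms \<phi> by (intro mult_left_mono) auto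
    have "(2 - \<gamma>) * (pi / 2) \<le> 2 * (pi / 2)" using assms by (intro mult_right_mono) auto
    then show "(2 - \<gamma>) * (pi / 2) \<le> pi" by simp
  qed
  have "cos (\<gamma> * \<phi>) \<le> cos ((2 - \<gamma>) * \<phi>)"
    using g by (intro cos_monotone_0_pi_le) auto
  moreover have "cos ((2 - \<gamma>) * (pi / 2)) \<le> cos ((2 - \<gamma>) * \<phi>)"
    using g by (intro cos_monotone_0_pi_le) auto
  moreover have "q_factor \<gamma> t = \<gamma> * cos ((2 - \<gamma>) * \<phi>) - (2 - \<gamma>) * cos (\<gamma> * \<phi>)"
    by (simp add: q_factor_def \<phi>_def)
  ultimately have "q_factor \<gamma> t \<ge> \<gamma> * cos ((2 - \<gamma>) * \<phi>) - (2 - \<gamma>) * cos ((2 - \<gamma>) * \<phi>)"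
    and le: "(2 * \<gamma> - 2) * cos ((2 - \<gamma>) * (pi / 2)) \<le> (2 * \<gamma> - 2) * cos ((2 - \<gamma>) * \<phi>)"
    using assms by (auto intro!: mult_left_mono)
  then have "q_factor \<gamma> t \<ge> (2 * \<gamma> - 2) * cos ((2 - \<gamma>) * \<phi>)"
    by (simp add: algebra_simps)
  with le show "q_lower \<gamma> \<le> q_factor \<gamma> t" unfolding q_lower_def by linarith
  have "q_factor \<gamma> t \<le> \<gamma> * 1 - (2 - \<gamma>) * (-1)"
    unfolding \<open>q_factor \<gamma> t = _\<close> using assms by (intro diff_mono mult_left_mono) auto
  then show "q_factor \<gamma> t \<le> 2" by simp
qed

text \<open>The restriction on the angle keeps \<open>ln \<rho> + \<i> * \<eta>\<close> in the range
  of the principal logarithm, so \<open>Ln\<close> inverts \<open>exp\<close> without a jump by a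
  multiple of 2 pi.\<close>

lemma powr_polar:
  assumes "\<rho> > 0" "- pi < \<eta>" "\<eta> \<le> pi"
  shows "(of_real \<rho> * cis \<eta>) powr of_real \<gamma> = of_real (\<rho> powr \<gamma>) * cis (\<gamma> * \<eta>)"
proof -
  have eq: "of_real \<rho> * cis \<eta> = exp (of_real (ln \<rho>) + \<i> * of_real \<eta>)"
    using assms by (simp add: exp_add cis_conv_exp exp_of_real)
  have "Ln (of_real \<rho> * cis \<eta>) = of_real (ln \<rho>) + \<i> * of_real \<eta>"
    unfolding eq using assms by (intro Ln_exp) auto
  moreover have "of_real \<rho> * cis \<eta> \<noteq> 0" using assms by simp
  ultimately have "(of_real \<rho> * cis \<eta>) powr of_real \<gamma> =
      exp (of_real (\<gamma> * ln \<rho>)) * exp (\<i> * of_real (\<gamma> * \<eta>))"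
    by (simp add: powr_def algebra_simps flip: exp_add)
  then show ?thesis
    using assms by (simp add: cis_conv_exp powr_def flip: exp_of_real)
qed

text \<open>Half-angle polar form: for \<open>t\<close> between 0 and pi the real factor is the
  modulus, and the angle lies between \<open>- pi / 2\<close> and 0, well inside the principal
  branch.\<close>

lemma one_minus_cis: "1 - cis t = of_real (2 * sin (t / 2)) * cis ((t - pi) / 2)"
proof -
  have t: "cos t = 1 - 2 * (sin (t / 2))\<^sup>2" "sin t = 2 * sin (t / 2) * cos (t / 2)"
    using cos_double_sin[of "t / 2"] sin_double[of "t / 2"] by simp_all
  have "cos ((t - pi) / 2) = sin (t / 2)" "sin ((t - pi) / 2) = - cos (t / 2)"
    by (simp_all add: diff_divide_distrib cos_diff sin_diff)
  then show ?thesis by (simp add: complex_eq_iff t power2_eq_square)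
qed

lemma one_minus_cis_minus: "1 - cis (- t) = of_real (2 * sin (t / 2)) * cis ((pi - t) / 2)"
  using one_minus_cis[of t, THEN arg_cong, of cnj]
  by (simp add: cis_cnj diff_divide_distrib)

lemma lap_symbol_powr:
  assumes "0 \<le> t" "t \<le> pi"
  shows "lap_symbol t powr (\<gamma> / 2) = (2 * sin (t / 2)) powr \<gamma>"
proof -
  have "sin (t / 2) \<ge> 0" using assms by (intro sin_ge_zero) auto
  moreover have "lap_symbol t = (2 * sin (t / 2)) powr 2"
    using calculation cos_double_sin[of "t / 2"] by (simp add: lap_symbol_def power2_eq_square)
  ultimately show ?thesis by (simp only: powr_powr) simp
qed

text \<open>The two summands are complex conjugates, so twice a real part remains. With
  \<open>t = pi - 2 * \<eta>\<close> the cosine of \<open>t + \<gamma> * \<eta>\<close> becomes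
  minus that of \<open>(2 - \<gamma>) * \<eta>\<close>, which produces
  \<open>q_factor\<close>.\<close>

lemma q_symbol_eq_q_real_nonneg:
  assumes "\<gamma> > 0" "0 \<le> t" "t \<le> pi"
  shows "q_symbol \<gamma> t = of_real (q_real \<gamma> t)"
proof (cases "t = 0")
  \<comment> \<open>The polar form degenerates at angle 0; both sides are 0 there because a power of
    0 is 0.\<close>
  case True
  then show ?thesis by (simp add: q_symbol_def w_symbol_def q_real_def lap_symbol_def)
next
  case False
  define \<rho> \<eta> where "\<rho> = 2 * sin (t / 2)" and "\<eta> = (pi - t) / 2"
  have \<rho>: "\<rho> > 0" using assms False unfolding \<rho>_def by (simp add: sin_gt_zero)
  have e: "exp (\<i> * of_real t) = cis t" "exp (- (\<i> * of_real t)) = cis (- t)"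
    by (simp_all add: cis_conv_exp)
  have \<eta>: "- pi < - \<eta>" "- \<eta> \<le> pi" "- pi < \<eta>" "\<eta> \<le> pi"
    unfolding \<eta>_def using assms pi_gt_zero by argo+
  have "1 - cis t = of_real \<rho> * cis (- \<eta>)"
    unfolding one_minus_cis \<rho>_def \<eta>_def by (simp add: diff_divide_distrib)
  then have p1: "(1 - cis t) powr of_real \<gamma> = of_real (\<rho> powr \<gamma>) * cis (\<gamma> * (- \<eta>))"
    using powr_polar[OF \<rho> \<eta>(1,2)] by (simp only:)
  have "1 - cis (- t) = of_real \<rho> * cis \<eta>"
    unfolding one_minus_cis_minus \<rho>_def \<eta>_def ..
  then have p2: "(1 - cis (- t)) powr of_real \<gamma> = of_real (\<rho> powr \<gamma>) * cis (\<gamma> * \<eta>)"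
    using powr_polar[OF \<rho> \<eta>(3,4)] by (simp only:)
  have w1: "w_symbol \<gamma> t = - ((2 - of_real \<gamma> * (1 - cis (- t))) / 2) *
      (of_real (\<rho> powr \<gamma>) * cis (\<gamma> * (- \<eta>)))"
    unfolding w_symbol_def e p1 ..
  have w2: "w_symbol \<gamma> (- t) = - ((2 - of_real \<gamma> * (1 - cis t)) / 2) *
      (of_real (\<rho> powr \<gamma>) * cis (\<gamma> * \<eta>))"
    unfolding w_symbol_def p2[symmetric] by (simp add: e)
  have "t = pi - 2 * \<eta>" by (simp add: \<eta>_def field_simps)
  then have ts: "cos t = - cos (2 * \<eta>)" "sin t = sin (2 * \<eta>)"
    by simp_all
  have "cos ((2 - \<gamma>) * \<eta>) = cos (2 * \<eta>) * cos (\<gamma> * \<eta>) + sin (2 * \<eta>) * sin (\<gamma> * \<eta>)"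
    by (simp add: left_diff_distrib cos_diff)
  moreover have "q_factor \<gamma> t = \<gamma> * cos ((2 - \<gamma>) * \<eta>) - (2 - \<gamma>) * cos (\<gamma> * \<eta>)"
    using assms by (simp add: q_factor_def \<eta>_def)
  moreover have "lap_symbol t powr (\<gamma> / 2) = \<rho> powr \<gamma>"
    unfolding \<rho>_def by (rule lap_symbol_powr) (use assms in auto)
  ultimately have q: "q_real \<gamma> t = \<rho> powr \<gamma> *
      (\<gamma> * (cos (2 * \<eta>) * cos (\<gamma> * \<eta>) + sin (2 * \<eta>) * sin (\<gamma> * \<eta>)) - (2 - \<gamma>) * cos (\<gamma> * \<eta>))"
    by (simp add: q_real_def)
  show ?thesis
    unfolding q_symbol_def w1 w2 q
    by (simp add: complex_eq_iff ts) (simp add: field_simps)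
qed

lemma q_symbol_eq_q_real:
  assumes "\<gamma> > 0" "t \<in> {-pi..pi}"
  shows "q_symbol \<gamma> t = of_real (q_real \<gamma> t)"
proof (cases "t \<ge> 0")
  case False
  have "q_symbol \<gamma> t = q_symbol \<gamma> (- t)" by (simp add: q_symbol_def add.commute)
  also have "\<dots> = of_real (q_real \<gamma> (- t))"
    using assms False by (intro q_symbol_eq_q_real_nonneg) auto
  also have "q_real \<gamma> (- t) = q_real \<gamma> t"
    by (simp add: q_real_def q_factor_def lap_symbol_def)
  finally show ?thesis .
qed (use assms q_symbol_eq_q_real_nonneg in auto)

lemma continuous_on_q_real [continuous_intros]:
  assumes "\<gamma> > 0"
  shows "continuous_on A (q_real \<gamma>)"
  unfolding q_real_def q_factor_def using assms
  by (intro continuous_intros continuous_on_powr') (auto simp: lap_symbol_nonneg)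

lemma q_real_bounds:
  assumes "1 < \<gamma>" "\<gamma> < 2" "t \<in> {-pi..pi}"
  shows "q_lower \<gamma> * lap_symbol t powr (\<gamma> / 2) \<le> q_real \<gamma> t"
    and "q_real \<gamma> t \<le> 2 * lap_symbol t powr (\<gamma> / 2)" and "q_real \<gamma> t \<ge> 0"
proof -
  show "q_lower \<gamma> * lap_symbol t powr (\<gamma> / 2) \<le> q_real \<gamma> t"
    "q_real \<gamma> t \<le> 2 * lap_symbol t powr (\<gamma> / 2)"
    unfolding q_real_def using q_factor_bounds[OF assms] by (simp_all add: mult.commute[of _ "lap_symbol t powr _"] mult_left_mono)
  show "q_real \<gamma> t \<ge> 0"
    unfolding q_real_def using q_factor_bounds(1)[OF assms] q_lower_pos[OF assms(1,2)] by simp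
qed

section \<open>Two-sided form bounds in one space direction\<close>

lemma grid_in_period:
  fixes j N :: int
  assumes "j \<in> {1..<N}"
  shows "of_int j * pi / of_int N \<in> {-pi..pi}"
proof -
  have "0 \<le> of_int j * pi / real_of_int N" using assms by simp
  moreover have "of_int j * pi / of_int N \<le> of_int N * pi / real_of_int N"
    using assms by (intro divide_right_mono mult_right_mono) auto
  moreover have "- pi \<le> 0" "of_int N * pi / real_of_int N = pi" using assms by simp_all
  ultimately show ?thesis unfolding atLeastAtMost_iff by linarith
qed

text \<open>The numerator is 2 * 20, the upper bound of \<open>q_factor\<close> times the reflection
  constant. One value serves both directions.\<close>

definition equiv_const :: "real \<Rightarrow> real" where
  "equiv_const \<gamma> = 40 / q_lower \<gamma>"

lemma equiv_const_ge:
  assumes "1 < \<gamma>" "\<gamma> < 2"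
  shows "equiv_const \<gamma> \<ge> 20"
proof -
  have "q_lower \<gamma> \<le> 2"
    using q_factor_bounds[OF assms, of 0] by simp
  then show ?thesis using q_lower_pos[OF assms] by (simp add: equiv_const_def field_simps)
qed

lemma q_form_equiv:
  fixes L :: int and u :: "int \<Rightarrow> complex"
  assumes "1 < \<gamma>" "\<gamma> < 2" "L > 0"
  defines "T \<equiv> mean (\<lambda>t. q_real \<gamma> t * (cmod (trig {1..<L} u t))\<^sup>2)"
    and "S \<equiv> (\<Sum>j\<in>{1..<L}. q_real \<gamma> (of_int j * pi / of_int L) * (cmod (dst L u j))\<^sup>2)"
  shows "T \<le> equiv_const \<gamma> * S" "S \<le> equiv_const \<gamma> * T"
proof -
  define T' where "T' = mean (\<lambda>t. lap_symbol t powr (\<gamma> / 2) * (cmod (trig {1..<L} u t))\<^sup>2)"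
  define S' where "S' = (\<Sum>j\<in>{1..<L}. lap_symbol (of_int j * pi / of_int L) powr (\<gamma> / 2) * (cmod (dst L u j))\<^sup>2)"
  let ?c = "q_lower \<gamma>"
  have c: "?c > 0" by (rule q_lower_pos) fact+
  have cont: "continuous_on {-pi..pi} (\<lambda>t. lap_symbol t powr (\<gamma> / 2) * (cmod (trig {1..<L} u t))\<^sup>2)"
    using assms by (intro continuous_intros continuous_on_powr') (auto simp: lap_symbol_nonneg)
  have contq: "continuous_on {-pi..pi} (\<lambda>t. q_real \<gamma> t * (cmod (trig {1..<L} u t))\<^sup>2)"
    using assms by (intro continuous_intros) auto
  have 1: "?c * T' \<le> T"
    unfolding T_def T'_def mean_cmult_right[OF cont, symmetric] using assms q_real_bounds(1)
    by (intro mean_mono continuous_on_mult[OF continuous_on_const cont] contq)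
      (auto simp flip: mult.assoc intro!: mult_right_mono)
  have 2: "T \<le> 2 * T'"
    unfolding T_def T'_def mean_cmult_right[OF cont, symmetric] using assms q_real_bounds(2)
    by (intro mean_mono continuous_on_mult[OF continuous_on_const cont] contq)
      (auto simp flip: mult.assoc intro!: mult_right_mono)
  have 3: "?c * S' \<le> S"
    unfolding S_def S'_def sum_distrib_left mult.assoc[symmetric]
    by (intro sum_mono mult_right_mono q_real_bounds(1) assms grid_in_period) auto
  have 4: "S \<le> 2 * S'"
    unfolding S_def S'_def sum_distrib_left mult.assoc[symmetric]
    by (intro sum_mono mult_right_mono q_real_bounds(2) assms grid_in_period) auto
  have 5: "T' \<le> S'" unfolding T'_def S'_def using assms by (intro trig_powr_le_dst) auto
  have 6: "S' \<le> 20 * T'" unfolding T'_def S'_def using assms by (intro dst_le_trig_powr) auto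
  \<comment> \<open>Used to enlarge the factor 2, which the direction without reflection yields, to
    the common 40.\<close>
  have "S \<ge> 0"
    unfolding S_def by (intro sum_nonneg mult_nonneg_nonneg q_real_bounds assms grid_in_period) auto
  have "?c * T \<le> 2 * (?c * S')" using 2 5 c mult_left_mono[of T "2 * S'" ?c] by simp
  with 3 \<open>S \<ge> 0\<close> have "?c * T \<le> 40 * S" by linarith
  then show "T \<le> equiv_const \<gamma> * S" using c by (simp add: equiv_const_def field_simps)
  have "?c * S \<le> 40 * (?c * T')" using 4 6 c mult_left_mono[of S "40 * T'" ?c] by simp
  with 1 have "?c * S \<le> 40 * T" by linarith
  then show "S \<le> equiv_const \<gamma> * T" using c by (simp add: equiv_const_def field_simps)
qed

text \<open>By Parseval the shift adds \<open>b\<close> times the squared norm of \<open>u\<close>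
  to both forms, and \<open>equiv_const \<gamma>\<close> exceeds 1. The constant is the same for all
  \<open>b\<close> and \<open>d\<close> allowed here, which is how the mesh ratios leave the
  estimate.\<close>

lemma shifted_q_form_equiv:
  fixes L :: int and u :: "int \<Rightarrow> complex"
  assumes "1 < \<gamma>" "\<gamma> < 2" "L > 0" "b \<ge> 0" "d \<ge> 0"
  defines "T \<equiv> mean (\<lambda>t. (b + d * q_real \<gamma> t) * (cmod (trig {1..<L} u t))\<^sup>2)"
    and "S \<equiv> (\<Sum>j\<in>{1..<L}. (b + d * q_real \<gamma> (of_int j * pi / of_int L)) * (cmod (dst L u j))\<^sup>2)"
  shows "T \<le> equiv_const \<gamma> * S" "S \<le> equiv_const \<gamma> * T"
proof -
  let ?U = "\<Sum>x\<in>{1..<L}. (cmod (u x))\<^sup>2" and ?K = "equiv_const \<gamma>"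
  let ?T = "mean (\<lambda>t. q_real \<gamma> t * (cmod (trig {1..<L} u t))\<^sup>2)"
  let ?S = "\<Sum>j\<in>{1..<L}. q_real \<gamma> (of_int j * pi / of_int L) * (cmod (dst L u j))\<^sup>2"
  have "T = mean (\<lambda>t. b * (cmod (trig {1..<L} u t))\<^sup>2 + d * (q_real \<gamma> t * (cmod (trig {1..<L} u t))\<^sup>2))"
    unfolding T_def by (intro mean_cong) (simp add: algebra_simps)
  also have "\<dots> = mean (\<lambda>t. b * (cmod (trig {1..<L} u t))\<^sup>2) +
      mean (\<lambda>t. d * (q_real \<gamma> t * (cmod (trig {1..<L} u t))\<^sup>2))"
    using assms by (intro mean_add continuous_intros) auto
  also have "mean (\<lambda>t. b * (cmod (trig {1..<L} u t))\<^sup>2) = b * ?U"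
    by (subst mean_cmult_right) (auto intro!: continuous_intros simp: parseval_trig)
  also have "mean (\<lambda>t. d * (q_real \<gamma> t * (cmod (trig {1..<L} u t))\<^sup>2)) = d * ?T"
    using assms by (intro mean_cmult_right continuous_intros) auto
  finally have T: "T = b * ?U + d * ?T" .
  have S: "S = b * ?U + d * ?S"
    unfolding S_def dst_parseval[of L u, symmetric]
    by (simp add: distrib_right sum.distrib sum_distrib_left mult.assoc)
  have bU: "b * ?U \<le> ?K * (b * ?U)"
  proof -
    have "0 \<le> b * ?U" using assms(4) by (intro mult_nonneg_nonneg sum_nonneg) auto
    from mult_right_mono[OF _ this, of 1 ?K] show ?thesis
      using equiv_const_ge[OF assms(1,2)] by simp
  qed
  have "d * ?T \<le> ?K * (d * ?S)" "d * ?S \<le> ?K * (d * ?T)"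
    using q_form_equiv[OF assms(1-3), of u] mult_left_mono[OF _ assms(5)]
    by (simp_all add: mult.left_commute[of _ d])
  with bU show "T \<le> ?K * S" "S \<le> ?K * T"
    unfolding T S by (simp_all add: distrib_left)
qed

text \<open>Lebesgue and gauge integral agree for a continuous integrand. Equality is asked only on
  the period, since \<open>q_symbol\<close> is identified with \<open>q_real\<close> only
  there.\<close>

lemma fourier_coeff_eq_coef:
  assumes "continuous_on {-pi..pi} f" "\<And>t. t \<in> {-pi..pi} \<Longrightarrow> g t = f t"
  shows "fourier_coeff g k = coef f k"
proof -
  have e: "exp (- (\<i> * of_int k * of_real t)) = cis (- of_int k * t)" for t
    by (simp add: cis_conv_exp mult.assoc)
  have c: "continuous_on {-pi..pi} (\<lambda>t. f t * cis (- of_int k * t))"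
    using assms(1) by (intro continuous_intros)
  have "(LINT \<theta>:{-pi..pi}|lebesgue. g \<theta> * exp (- (\<i> * of_int k * of_real \<theta>))) =
      (LINT \<theta>:{-pi..pi}|lebesgue. f \<theta> * cis (- of_int k * \<theta>))"
    by (intro set_lebesgue_integral_cong) (auto simp: assms(2) e)
  also have "\<dots> = integral {-pi..pi} (\<lambda>t. f t * cis (- of_int k * t))"
    by (intro set_lebesgue_integral_eq_integral absolutely_integrable_continuous_real c)
  finally show ?thesis
    by (simp add: fourier_coeff_def coef_def mean_def scaleR_conv_of_real)
qed

text \<open>Multiplying a trigonometric polynomial by \<open>f\<close> convolves its coefficients
  with those of \<open>f\<close>, which is the action of the Toeplitz matrix; pairing with the
  polynomial itself gives the mean.\<close>

lemma toeplitz_form: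
  fixes f :: "real \<Rightarrow> real"
  assumes "continuous_on {-pi..pi} f" "finite X"
  shows "(\<Sum>x\<in>X. \<Sum>y\<in>X. cnj (u x) * coef (\<lambda>t. of_real (f t)) (x - y) * u y) =
    of_real (mean (\<lambda>t. f t * (cmod (trig X u t))\<^sup>2))"
proof -
  have "of_real (mean (\<lambda>t. f t * (cmod (trig X u t))\<^sup>2)) =
      mean (\<lambda>t. complex_of_real (f t * (cmod (trig X u t))\<^sup>2))"
    using assms by (intro mean_of_real[symmetric] continuous_intros)
  also have "\<dots> = mean (\<lambda>t. (of_real (f t) * trig X u t) * cnj (trig X u t))"
    by (simp add: complex_norm_square mult.assoc del: of_real_power)
  also have "\<dots> = (\<Sum>x\<in>X. coef (\<lambda>t. of_real (f t) * trig X u t) x * cnj (u x))"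
    using assms by (intro mean_mult_cnj_trig continuous_intros)
  also have "\<dots> = (\<Sum>x\<in>X. (\<Sum>y\<in>X. u y * coef (\<lambda>t. of_real (f t)) (x - y)) * cnj (u x))"
  proof -
    have "coef (\<lambda>t. of_real (f t) * trig X u t) x = (\<Sum>y\<in>X. u y * coef (\<lambda>t. of_real (f t)) (x - y))" for x
    proof -
      have e: "cis (- of_int (x - y) * t) = cis (of_int y * t) * cis (- of_int x * t)" for y t
        by (simp add: cis_mult algebra_simps)
      have "coef (\<lambda>t. of_real (f t) * trig X u t) x =
          mean (\<lambda>t. \<Sum>y\<in>X. u y * (of_real (f t) * cis (- of_int (x - y) * t)))"
        unfolding coef_def trig_def e
        by (intro mean_cong) (simp add: sum_distrib_left sum_distrib_right mult_ac)
      also have "\<dots> = (\<Sum>y\<in>X. mean (\<lambda>t. u y * (of_real (f t) * cis (- of_int (x - y) * t))))"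
        using assms by (intro mean_sum continuous_intros)
      also have "\<dots> = (\<Sum>y\<in>X. u y * coef (\<lambda>t. of_real (f t)) (x - y))"
        unfolding coef_def using assms by (intro sum.cong refl mean_cmult_right continuous_intros)
      finally show ?thesis .
    qed
    then show ?thesis by simp
  qed
  also have "\<dots> = (\<Sum>x\<in>X. \<Sum>y\<in>X. cnj (u x) * coef (\<lambda>t. of_real (f t)) (x - y) * u y)"
    by (simp add: sum_distrib_left sum_distrib_right mult_ac)
  finally show ?thesis by simp
qed

section \<open>Matrix pencils and Kronecker sums\<close>

definition quad_form :: "complex Matrix.mat \<Rightarrow> complex Matrix.vec \<Rightarrow> complex" where
  "quad_form A v = (\<Sum>k<dim_row A. cnj (v $ k) * (A *\<^sub>v v) $ k)"

lemma quad_form_eq: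
  assumes "A \<in> carrier_mat n n" "v \<in> carrier_vec n"
  shows "quad_form A v = (\<Sum>k<n. \<Sum>l<n. cnj (v $ k) * A $$ (k, l) * v $ l)"
  using assms
  by (auto simp: quad_form_def scalar_prod_def sum_distrib_left mult.assoc atLeast0LessThan intro!: sum.cong)

text \<open>A singular \<open>P\<close> would have a nonzero null vector, on which its form
  vanishes. For an eigenvector, \<open>A v = z P v\<close>, so \<open>z\<close> is the quotient
  \<open>a v / p v\<close> of two real forms; this makes the spectrum real although the product
  itself need not be Hermitian.\<close>

lemma spectrum_pencil_bounds:
  assumes A: "A \<in> carrier_mat n n" and P: "P \<in> carrier_mat n n" and K: "K > 0"
    and forms: "\<And>v. v \<in> carrier_vec n \<Longrightarrow> v \<noteq> 0\<^sub>v n \<Longrightarrow> quad_form A v = complex_of_real (a v) \<and>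
      quad_form P v = complex_of_real (p v) \<and> p v > 0 \<and> a v \<le> K * p v \<and> p v \<le> K * a v"
  shows "invertible_mat P \<and> spectrum (the (mat_inverse P) * A) \<subseteq> complex_of_real ` {1 / K..K}"
proof -
  have "det P \<noteq> 0"
  proof
    assume "det P = 0"
    then obtain v where v: "v \<in> carrier_vec n" "v \<noteq> 0\<^sub>v n" "P *\<^sub>v v = 0\<^sub>v n"
      using det_0_iff_vec_prod_zero[OF P] by auto
    then have "quad_form P v = 0" using P by (simp add: quad_form_def)
    then show False using forms[OF v(1,2)] by auto
  qed
  then have "P \<in> Units (ring_mat TYPE(complex) n ())"
    by (rule det_non_zero_imp_unit[OF P])
  then obtain B where B: "mat_inverse P = Some B"
    using mat_inverse(1)[OF P, where b = "()"] by (cases "mat_inverse P") auto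
  have PB: "P * B = 1\<^sub>m n" "B * P = 1\<^sub>m n" "B \<in> carrier_mat n n"
    using mat_inverse(2)[OF P B] by auto
  have "invertible_mat P"
    unfolding invertible_mat_def inverts_mat_def using PB P by auto
  moreover have "spectrum (B * A) \<subseteq> complex_of_real ` {1 / K..K}"
  proof
    fix z assume "z \<in> spectrum (B * A)"
    then obtain v where v: "v \<in> carrier_vec n" "v \<noteq> 0\<^sub>v n" "(B * A) *\<^sub>v v = z \<cdot>\<^sub>v v"
      unfolding spectrum_def eigenvalue_def eigenvector_def using PB(3) A by auto
    have "A *\<^sub>v v = (P * B * A) *\<^sub>v v"
      using A PB by simp
    also have "\<dots> = P *\<^sub>v ((B * A) *\<^sub>v v)"
      using A PB(3) P v(1) by (simp add: assoc_mult_mat_vec[of _ n n _ n] assoc_mult_mat[of _ n n _ n])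
    also have "\<dots> = z \<cdot>\<^sub>v (P *\<^sub>v v)"
      unfolding v(3) using P v(1) by (simp add: mult_mat_vec)
    finally have "quad_form A v = z * quad_form P v"
      using A P by (simp add: quad_form_def sum_distrib_left mult.left_commute)
    then have "complex_of_real (a v) = z * complex_of_real (p v)" and pv: "p v > 0"
      and le: "a v \<le> K * p v" "p v \<le> K * a v"
      using forms[OF v(1,2)] by auto
    then have "z = complex_of_real (a v / p v)" by (simp add: field_simps)
    moreover have "a v / p v \<in> {1 / K..K}"
      using pv le K by (auto simp: field_simps)
    ultimately show "z \<in> complex_of_real ` {1 / K..K}" by blast
  qed
  ultimately show ?thesis using B by simp
qed

section \<open>Index arithmetic for flattened pairs, diagonal blocks and Kronecker products\<close>

lemma sum_product_index:
  fixes f :: "nat \<Rightarrow> nat \<Rightarrow> 'a::comm_monoid_add"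
  shows "(\<Sum>k<m * n. f (k div n) (k mod n)) = (\<Sum>j<m. \<Sum>i<n. f j i)"
proof (cases "n = 0")
  case False
  then have n: "n > 0" by simp
  have "(\<Sum>j<m. \<Sum>i<n. f j i) = (\<Sum>(j, i)\<in>{..<m} \<times> {..<n}. f j i)"
    by (simp add: sum.cartesian_product)
  also have "\<dots> = (\<Sum>k<m * n. f (k div n) (k mod n))"
  proof (rule sum.reindex_bij_witness[of _ "\<lambda>k. (k div n, k mod n)" "\<lambda>(j, i). j * n + i"])
    fix a assume a: "a \<in> {..<m} \<times> {..<n}"
    then obtain j i where ji: "a = (j, i)" "j < m" "i < n" by auto
    have "j * n + i < (j + 1) * n" using ji by simp
    also have "\<dots> \<le> m * n" using ji by (intro mult_right_mono) auto
    finally show "(case a of (j, i) \<Rightarrow> j * n + i) \<in> {..<m * n}" using ji by simp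
  qed (use n in \<open>auto simp: less_mult_imp_div_less\<close>)
  finally show ?thesis by simp
qed simp

text \<open>The dictionary between matrix indices, which start at 0, and positions of sequences,
  which start at 1.\<close>

lemma sum_int_shift: "(\<Sum>i<n. g (int i + 1)) = (\<Sum>x\<in>{1..<int n + 1}. g x)"
  by (rule sum.reindex_bij_witness[of _ "\<lambda>x. nat (x - 1)" "\<lambda>i. int i + 1"]) auto

lemma mat_diag_blocks:
  "diag_block_mat (map (\<lambda>j. mat_diag n (f j)) [0..<m]) =
    mat_diag (m * n) (\<lambda>k. f (k div n) (k mod n) :: 'a::zero)"
proof (induction m)
  case 0
  show ?case by (auto simp: mat_diag_def)
next
  case (Suc m)
  have "diag_block_mat (map (\<lambda>j. mat_diag n (f j)) [0..<Suc m]) =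
      four_block_mat (mat_diag (m * n) (\<lambda>k. f (k div n) (k mod n)))
        (0\<^sub>m (m * n) n) (0\<^sub>m n (m * n)) (mat_diag n (f m))"
    using Suc by (simp add: diag_block_mat_append Let_def del: diag_block_mat.simps)
        (simp add: mat_diag_def)
  also have "\<dots> = mat_diag (Suc m * n) (\<lambda>k. f (k div n) (k mod n))"
  proof (rule eq_matI)
    fix k l assume "k < dim_row (mat_diag (Suc m * n) (\<lambda>k. f (k div n) (k mod n)))"
      "l < dim_col (mat_diag (Suc m * n) (\<lambda>k. f (k div n) (k mod n)))"
    then have kl: "k < Suc m * n" "l < Suc m * n" by (simp_all add: mat_diag_def)
    have last: "k div n = m" "k mod n = k - m * n" if "\<not> k < m * n" "k < Suc m * n" for k
    proof -
      show *: "k div n = m" using that by (intro div_nat_eqI) (simp_all add: mult.commute)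
      show "k mod n = k - m * n" unfolding modulo_nat_def * ..
    qed
    have "four_block_mat (mat_diag (m * n) (\<lambda>k. f (k div n) (k mod n)))
        (0\<^sub>m (m * n) n) (0\<^sub>m n (m * n)) (mat_diag n (f m)) $$ (k, l) =
      (if k = l then f (k div n) (k mod n) else 0)"
    proof (cases "l < m * n")
      case True
      then show ?thesis using kl by (auto simp: mat_diag_def)
    next
      case False
      then have "l - m * n < n" using kl by auto
      with False show ?thesis
        using kl last[OF False kl(2)] by (cases "k < m * n") (simp_all add: mat_diag_def, linarith?)
    qed
    then show "four_block_mat (mat_diag (m * n) (\<lambda>k. f (k div n) (k mod n)))
        (0\<^sub>m (m * n) n) (0\<^sub>m n (m * n)) (mat_diag n (f m)) $$ (k, l) =
      mat_diag (Suc m * n) (\<lambda>k. f (k div n) (k mod n)) $$ (k, l)"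
      using kl by (simp add: mat_diag_def)
  qed (simp_all add: mat_diag_def)
  finally show ?case .
qed

lemma sum_delta_outer:
  fixes g :: "nat \<Rightarrow> 'b \<Rightarrow> 'a::comm_monoid_add"
  assumes "j < n"
  shows "(\<Sum>j'<n. \<Sum>i\<in>I. if j = j' then g j' i else 0) = (\<Sum>i\<in>I. g j i)"
proof -
  have "(\<Sum>j'<n. \<Sum>i\<in>I. if j = j' then g j' i else 0) = (\<Sum>j'<n. if j = j' then \<Sum>i\<in>I. g j' i else 0)"
    by (intro sum.cong) auto
  then show ?thesis using assms by simp
qed

text \<open>Each identity factor freezes one index. With \<open>v\<close> read as a grid, forms of
  \<open>S\<close> along its rows and forms of \<open>T\<close> along its columns remain.\<close>

lemma quad_form_kron_sum:
  assumes S: "S \<in> carrier_mat n n" and T: "T \<in> carrier_mat m m" and v: "v \<in> carrier_vec (m * n)"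
  shows "quad_form (1\<^sub>m m \<otimes>\<^sub>K S + T \<otimes>\<^sub>K 1\<^sub>m n) v =
    (\<Sum>j<m. \<Sum>i<n. \<Sum>i'<n. cnj (v $ (j * n + i)) * S $$ (i, i') * v $ (j * n + i')) +
    (\<Sum>i<n. \<Sum>j<m. \<Sum>j'<m. cnj (v $ (j * n + i)) * T $$ (j, j') * v $ (j' * n + i))"
proof -
  let ?W = "\<lambda>j i. v $ (j * n + i)"
  let ?A = "1\<^sub>m m \<otimes>\<^sub>K S + T \<otimes>\<^sub>K 1\<^sub>m n"
  let ?s = "\<lambda>j i j' i'. if j = j' then cnj (?W j i) * S $$ (i, i') * ?W j' i' else 0"
  let ?t = "\<lambda>j i j' i'. if i = i' then cnj (?W j i) * T $$ (j, j') * ?W j' i' else 0"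
  have carr: "?A \<in> carrier_mat (m * n) (m * n)"
    using S T by (auto simp: kron_def)
  have entry: "cnj (v $ k) * ?A $$ (k, l) * v $ l =
      ?s (k div n) (k mod n) (l div n) (l mod n) + ?t (k div n) (k mod n) (l div n) (l mod n)"
    if "k < m * n" "l < m * n" for k l
  proof -
    have "n > 0" using that by (cases n) auto
    then have "k div n < m" "l div n < m" "k mod n < n" "l mod n < n"
      using that by (auto simp: less_mult_imp_div_less)
    then have "?A $$ (k, l) = (if k div n = l div n then S $$ (k mod n, l mod n) else 0) +
        (if k mod n = l mod n then T $$ (k div n, l div n) else 0)"
      using that S T by (simp add: kron_def)
    then show ?thesis
      unfolding div_mult_mod_eq by (simp add: distrib_left distrib_right)
  qed
  have "quad_form ?A v = (\<Sum>k<m * n. \<Sum>l<m * n. cnj (v $ k) * ?A $$ (k, l) * v $ l)"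
    by (rule quad_form_eq[OF carr v])
  also have "\<dots> = (\<Sum>k<m * n. \<Sum>l<m * n.
      ?s (k div n) (k mod n) (l div n) (l mod n) + ?t (k div n) (k mod n) (l div n) (l mod n))"
    by (intro sum.cong) (auto simp only: entry lessThan_iff)
  also have "\<dots> = (\<Sum>k<m * n. \<Sum>j'<m. \<Sum>i'<n. ?s (k div n) (k mod n) j' i' + ?t (k div n) (k mod n) j' i')"
    by (rule sum.cong[OF refl], rule sum_product_index)
  also have "\<dots> = (\<Sum>j<m. \<Sum>i<n. \<Sum>j'<m. \<Sum>i'<n. ?s j i j' i' + ?t j i j' i')"
    by (rule sum_product_index)
  also have "\<dots> = (\<Sum>j<m. \<Sum>i<n. \<Sum>j'<m. \<Sum>i'<n. ?s j i j' i') + (\<Sum>j<m. \<Sum>i<n. \<Sum>j'<m. \<Sum>i'<n. ?t j i j' i')"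
    by (simp only: sum.distrib)
  also have "(\<Sum>j<m. \<Sum>i<n. \<Sum>j'<m. \<Sum>i'<n. ?s j i j' i') =
      (\<Sum>j<m. \<Sum>i<n. \<Sum>i'<n. cnj (?W j i) * S $$ (i, i') * ?W j i')"
    by (intro sum.cong refl sum_delta_outer) simp
  also have "(\<Sum>j<m. \<Sum>i<n. \<Sum>j'<m. \<Sum>i'<n. ?t j i j' i') =
      (\<Sum>j<m. \<Sum>i<n. \<Sum>j'<m. cnj (?W j i) * T $$ (j, j') * ?W j' i)"
    by (intro sum.cong refl) simp
  also have "\<dots> = (\<Sum>i<n. \<Sum>j<m. \<Sum>j'<m. cnj (?W j i) * T $$ (j, j') * ?W j' i)"
    by (rule sum.swap)
  finally show ?thesis .
qed

text \<open>By \<open>sym\<close> the matrix \<open>Z\<close> is Hermitian, so its left copy can be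
  moved onto the conjugated vector; the form is then diagonal in the coordinates
  \<open>Z v\<close>.\<close>

lemma quad_form_congruence_diag:
  assumes Z: "Z \<in> carrier_mat N N" and v: "v \<in> carrier_vec N"
    and sym: "\<And>k l. k < N \<Longrightarrow> l < N \<Longrightarrow> cnj (Z $$ (k, l)) = Z $$ (l, k)"
  shows "quad_form (Z * mat_diag N f * Z) v = (\<Sum>k<N. f k * of_real ((cmod ((Z *\<^sub>v v) $ k))\<^sup>2))"
proof -
  let ?w = "Z *\<^sub>v v"
  have D: "mat_diag N f \<in> carrier_mat N N" by simp
  have w: "?w \<in> carrier_vec N" using Z v by simp
  have Dw: "(mat_diag N f *\<^sub>v ?w) $ k = f k * ?w $ k" if "k < N" for k
  proof -
    have "(mat_diag N f *\<^sub>v ?w) $ k = (\<Sum>l<N. (if k = l then f l else 0) * ?w $ l)"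
      using that Z by (simp add: mat_diag_def scalar_prod_def atLeast0LessThan)
    also have "\<dots> = (\<Sum>l<N. if k = l then f l * ?w $ l else 0)"
      by (intro sum.cong) auto
    finally show ?thesis using that by simp
  qed
  have Zx: "(Z *\<^sub>v x) $ k = (\<Sum>l<N. Z $$ (k, l) * x $ l)" if "x \<in> carrier_vec N" "k < N" for x k
    using Z that by (simp add: scalar_prod_def atLeast0LessThan)
  have Dwc: "mat_diag N f *\<^sub>v ?w \<in> carrier_vec N"
    using D w by (rule mult_mat_vec_carrier)
  have "(Z * mat_diag N f * Z) *\<^sub>v v = Z *\<^sub>v (mat_diag N f *\<^sub>v ?w)"
    using Z v D w by (simp add: assoc_mult_mat_vec[of _ N N _ N])
  then have "quad_form (Z * mat_diag N f * Z) v =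
      (\<Sum>k<N. cnj (v $ k) * (Z *\<^sub>v (mat_diag N f *\<^sub>v ?w)) $ k)"
    using Z by (simp add: quad_form_def del: index_mult_mat_vec)
  also have "\<dots> = (\<Sum>k<N. \<Sum>l<N. cnj (v $ k) * (Z $$ (k, l) * (f l * ?w $ l)))"
    by (simp add: Zx[OF Dwc] Dw sum_distrib_left del: index_mult_mat_vec)
  also have "\<dots> = (\<Sum>l<N. \<Sum>k<N. cnj (v $ k) * (Z $$ (k, l) * (f l * ?w $ l)))"
    by (rule sum.swap)
  also have "\<dots> = (\<Sum>l<N. f l * ?w $ l * cnj (?w $ l))"
  proof (intro sum.cong refl)
    fix l assume "l \<in> {..<N}"
    then have l: "l < N" by simp
    have "cnj (?w $ l) = (\<Sum>k<N. Z $$ (k, l) * cnj (v $ k))"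
      unfolding Zx[OF v l] using l by (simp add: sym)
    then show "(\<Sum>k<N. cnj (v $ k) * (Z $$ (k, l) * (f l * ?w $ l))) = f l * ?w $ l * cnj (?w $ l)"
      by (simp add: sum_distrib_left mult_ac del: index_mult_mat_vec)
  qed
  also have "\<dots> = (\<Sum>l<N. f l * of_real ((cmod (?w $ l))\<^sup>2))"
    by (simp add: complex_norm_square mult.assoc del: of_real_power index_mult_mat_vec)
  finally show ?thesis .
qed

lemma sine_mat_entry:
  assumes "i < n" "j < n"
  shows "sine_mat n $$ (i, j) = of_real (dst_entry (int n + 1) (int i + 1) (int j + 1))"
  using assms by (simp add: sine_mat_def dst_entry_def grid_angle_def add.commute mult_ac)

text \<open>The Kronecker product is one sine transform in each variable. The flattened vector is
  read as a function of two positions starting at 1, hence the shifts under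
  \<open>nat\<close>.\<close>

lemma sine_kron_mult_vec:
  assumes v: "v \<in> carrier_vec (m * n)" and k: "k < m * n"
  shows "((sine_mat m \<otimes>\<^sub>K sine_mat n) *\<^sub>v v) $ k =
    dst (int m + 1) (\<lambda>y. dst (int n + 1) (\<lambda>x. v $ (nat (y - 1) * n + nat (x - 1))) (int (k mod n) + 1))
      (int (k div n) + 1)"
proof -
  let ?L = "int m + 1" and ?M = "int n + 1"
  have n: "n > 0" using k by (cases n) auto
  let ?g = "\<lambda>j i. of_real (dst_entry ?L (int (k div n) + 1) (int j + 1)) *
      (of_real (dst_entry ?M (int (k mod n) + 1) (int i + 1)) * v $ (j * n + i))"
  have "((sine_mat m \<otimes>\<^sub>K sine_mat n) *\<^sub>v v) $ k =
      (\<Sum>l<m * n. (sine_mat m \<otimes>\<^sub>K sine_mat n) $$ (k, l) * v $ l)"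
    using v k by (simp add: kron_def sine_mat_def scalar_prod_def atLeast0LessThan)
  also have "\<dots> = (\<Sum>l<m * n. ?g (l div n) (l mod n))"
  proof (intro sum.cong refl)
    fix l assume "l \<in> {..<m * n}"
    then have l: "l < m * n" by simp
    have "(sine_mat m \<otimes>\<^sub>K sine_mat n) $$ (k, l) =
        sine_mat m $$ (k div n, l div n) * sine_mat n $$ (k mod n, l mod n)"
      using k l by (simp add: kron_def sine_mat_def)
    also have "\<dots> = of_real (dst_entry ?L (int (k div n) + 1) (int (l div n) + 1)) *
        of_real (dst_entry ?M (int (k mod n) + 1) (int (l mod n) + 1))"
      using k l n by (simp add: sine_mat_entry less_mult_imp_div_less)
    finally show "(sine_mat m \<otimes>\<^sub>K sine_mat n) $$ (k, l) * v $ l = ?g (l div n) (l mod n)"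
      by (simp add: mult.assoc)
  qed
  also have "\<dots> = (\<Sum>j<m. \<Sum>i<n. ?g j i)"
    by (rule sum_product_index)
  also have "\<dots> = dst ?L (\<lambda>y. dst ?M (\<lambda>x. v $ (nat (y - 1) * n + nat (x - 1))) (int (k mod n) + 1))
      (int (k div n) + 1)"
    unfolding dst_def sum_int_shift[symmetric] by (simp add: sum_distrib_left)
  finally show ?thesis .
qed

section \<open>Spectrum of the preconditioned matrix\<close>

lemma sine_kron_real_symmetric:
  assumes "k < m * n" "l < m * n"
  shows "cnj ((sine_mat m \<otimes>\<^sub>K sine_mat n) $$ (k, l)) = (sine_mat m \<otimes>\<^sub>K sine_mat n) $$ (l, k)"
proof -
  have "n > 0" using assms by (cases n) auto
  then have *: "k div n < m" "k mod n < n" "l div n < m" "l mod n < n"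
    using assms by (auto simp: less_mult_imp_div_less)
  have "(sine_mat m \<otimes>\<^sub>K sine_mat n) $$ (k, l) =
      sine_mat m $$ (k div n, l div n) * sine_mat n $$ (k mod n, l mod n)"
    "(sine_mat m \<otimes>\<^sub>K sine_mat n) $$ (l, k) =
      sine_mat m $$ (l div n, k div n) * sine_mat n $$ (l mod n, k mod n)"
    using assms by (simp_all add: kron_def sine_mat_def)
  then show ?thesis
    using * by (simp add: sine_mat_entry dst_entry_commute)
qed

lemma dst_swap:
  "dst L (\<lambda>y. dst M (\<lambda>x. V y x) a) b = dst M (\<lambda>x. dst L (\<lambda>y. V y x) b) a"
  unfolding dst_def sum_distrib_left
  by (subst sum.swap) (simp add: mult.left_commute)

text \<open>The eigenvalue is additive. In the part with \<open>g\<close> Parseval undoes the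
  transform in \<open>y\<close>; in the part with \<open>h\<close> the transforms are exchanged and
  Parseval undoes the one in \<open>x\<close>. One-dimensional forms along grid lines are
  left.\<close>

lemma dst2_form_split:
  fixes V :: "int \<Rightarrow> int \<Rightarrow> complex"
  shows "(\<Sum>b\<in>{1..<L}. \<Sum>a\<in>{1..<M}. (g a + h b) * (cmod (dst L (\<lambda>y. dst M (V y) a) b))\<^sup>2) =
    (\<Sum>y\<in>{1..<L}. \<Sum>a\<in>{1..<M}. g a * (cmod (dst M (V y) a))\<^sup>2) +
    (\<Sum>x\<in>{1..<M}. \<Sum>b\<in>{1..<L}. h b * (cmod (dst L (\<lambda>y. V y x) b))\<^sup>2)"
proof -
  let ?D = "\<lambda>b a. (cmod (dst L (\<lambda>y. dst M (V y) a) b))\<^sup>2"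
  have "(\<Sum>b\<in>{1..<L}. \<Sum>a\<in>{1..<M}. (g a + h b) * ?D b a) =
      (\<Sum>b\<in>{1..<L}. \<Sum>a\<in>{1..<M}. g a * ?D b a) + (\<Sum>b\<in>{1..<L}. \<Sum>a\<in>{1..<M}. h b * ?D b a)"
    by (simp add: distrib_right sum.distrib)
  also have "(\<Sum>b\<in>{1..<L}. \<Sum>a\<in>{1..<M}. g a * ?D b a) =
      (\<Sum>a\<in>{1..<M}. \<Sum>b\<in>{1..<L}. g a * ?D b a)"
    by (rule sum.swap)
  also have "\<dots> = (\<Sum>a\<in>{1..<M}. \<Sum>y\<in>{1..<L}. g a * (cmod (dst M (V y) a))\<^sup>2)"
    unfolding sum_distrib_left[symmetric] dst_parseval ..
  also have "\<dots> = (\<Sum>y\<in>{1..<L}. \<Sum>a\<in>{1..<M}. g a * (cmod (dst M (V y) a))\<^sup>2)"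
    by (rule sum.swap)
  also have "(\<Sum>b\<in>{1..<L}. \<Sum>a\<in>{1..<M}. h b * ?D b a) =
      (\<Sum>b\<in>{1..<L}. \<Sum>x\<in>{1..<M}. h b * (cmod (dst L (\<lambda>y. V y x) b))\<^sup>2)"
    unfolding sum_distrib_left[symmetric] dst_swap[of L M V] dst_parseval ..
  also have "\<dots> = (\<Sum>x\<in>{1..<M}. \<Sum>b\<in>{1..<L}. h b * (cmod (dst L (\<lambda>y. V y x) b))\<^sup>2)"
    by (rule sum.swap)
  finally show ?thesis .
qed

text \<open>The summand \<open>0 +\<close> makes the \<open>y\<close> part an instance of the
  shifted one-dimensional form with \<open>b = 0\<close>; all of \<open>1 / r\<close> goes to the
  \<open>x\<close> part, as in the coefficient matrix.\<close>

lemma precond_form: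
  assumes v: "v \<in> carrier_vec (n\<^sub>2 * n\<^sub>1)" and \<alpha>: "\<alpha> > 0" and \<beta>: "\<beta> > 0"
  defines "V \<equiv> \<lambda>y x. v $ (nat (y - 1) * n\<^sub>1 + nat (x - 1))"
    and "L \<equiv> int n\<^sub>2 + 1" and "M \<equiv> int n\<^sub>1 + 1"
  shows "quad_form (precond_mat \<alpha> \<beta> d e r s n\<^sub>1 n\<^sub>2) v = of_real
    ((\<Sum>y\<in>{1..<L}. \<Sum>a\<in>{1..<M}. (1 / r + d * q_real \<alpha> (of_int a * pi / of_int M)) * (cmod (dst M (V y) a))\<^sup>2) +
     (\<Sum>x\<in>{1..<M}. \<Sum>b\<in>{1..<L}. (0 + e * (s / r) * q_real \<beta> (of_int b * pi / of_int L)) *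
       (cmod (dst L (\<lambda>y. V y x) b))\<^sup>2))"
proof -
  let ?Z = "sine_mat n\<^sub>2 \<otimes>\<^sub>K sine_mat n\<^sub>1"
  let ?g = "\<lambda>a. 1 / r + d * q_real \<alpha> (of_int a * pi / of_int M)"
    and ?h = "\<lambda>b. 0 + e * (s / r) * q_real \<beta> (of_int b * pi / of_int L)"
  let ?W = "\<lambda>b a. dst L (\<lambda>y. dst M (V y) a) b"
  have Z: "?Z \<in> carrier_mat (n\<^sub>2 * n\<^sub>1) (n\<^sub>2 * n\<^sub>1)"
    by (simp add: kron_def sine_mat_def)
  have grid: "grid_angle n (j + 1) = of_int (int j + 1) * pi / of_int (int n + 1)"
    "grid_angle n (j + 1) \<in> {-pi..pi}" if "j < n" for n j
  proof -
    show "grid_angle n (j + 1) = of_int (int j + 1) * pi / of_int (int n + 1)"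
      by (simp add: grid_angle_def add.commute)
    then show "grid_angle n (j + 1) \<in> {-pi..pi}"
      using grid_in_period[of "int j + 1" "int n + 1"] that by simp
  qed
  have F: "F_symbol \<alpha> \<beta> d e r s (grid_angle n\<^sub>1 (i + 1)) (grid_angle n\<^sub>2 (j + 1)) =
      of_real (?g (int i + 1) + ?h (int j + 1))" if "i < n\<^sub>1" "j < n\<^sub>2" for i j
    unfolding F_symbol_def L_def M_def grid(1)[OF that(1), symmetric] grid(1)[OF that(2), symmetric]
      q_symbol_eq_q_real[OF \<alpha> grid(2)[OF that(1)]] q_symbol_eq_q_real[OF \<beta> grid(2)[OF that(2)]]
    by (simp only: of_real_add of_real_mult add_0_left mult.commute[of "s / r" e])
  have "quad_form (precond_mat \<alpha> \<beta> d e r s n\<^sub>1 n\<^sub>2) v =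
      (\<Sum>k<n\<^sub>2 * n\<^sub>1. F_symbol \<alpha> \<beta> d e r s (grid_angle n\<^sub>1 (k mod n\<^sub>1 + 1)) (grid_angle n\<^sub>2 (k div n\<^sub>1 + 1)) *
        of_real ((cmod ((?Z *\<^sub>v v) $ k))\<^sup>2))"
    unfolding precond_mat_def F_mat_def mat_diag_blocks
    by (rule quad_form_congruence_diag[OF Z v sine_kron_real_symmetric])
  also have "\<dots> = (\<Sum>k<n\<^sub>2 * n\<^sub>1. complex_of_real ((?g (int (k mod n\<^sub>1) + 1) + ?h (int (k div n\<^sub>1) + 1)) *
        (cmod (?W (int (k div n\<^sub>1) + 1) (int (k mod n\<^sub>1) + 1)))\<^sup>2))"
  proof (intro sum.cong refl)
    fix k assume "k \<in> {..<n\<^sub>2 * n\<^sub>1}"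
    then have k: "k < n\<^sub>2 * n\<^sub>1" by simp
    then have "n\<^sub>1 > 0" by (cases n\<^sub>1) auto
    then have *: "k mod n\<^sub>1 < n\<^sub>1" "k div n\<^sub>1 < n\<^sub>2" using k by (auto simp: less_mult_imp_div_less)
    show "F_symbol \<alpha> \<beta> d e r s (grid_angle n\<^sub>1 (k mod n\<^sub>1 + 1)) (grid_angle n\<^sub>2 (k div n\<^sub>1 + 1)) *
        of_real ((cmod ((?Z *\<^sub>v v) $ k))\<^sup>2) =
      complex_of_real ((?g (int (k mod n\<^sub>1) + 1) + ?h (int (k div n\<^sub>1) + 1)) *
        (cmod (?W (int (k div n\<^sub>1) + 1) (int (k mod n\<^sub>1) + 1)))\<^sup>2)"
      unfolding F[OF *] sine_kron_mult_vec[OF v k] V_def L_def M_def of_real_mult ..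
  qed
  also have "\<dots> = (\<Sum>j<n\<^sub>2. \<Sum>i<n\<^sub>1. complex_of_real ((?g (int i + 1) + ?h (int j + 1)) *
        (cmod (?W (int j + 1) (int i + 1)))\<^sup>2))"
    by (rule sum_product_index)
  also have "\<dots> = (\<Sum>b\<in>{1..<L}. \<Sum>a\<in>{1..<M}. complex_of_real ((?g a + ?h b) * (cmod (?W b a))\<^sup>2))"
    unfolding L_def M_def sum_int_shift[symmetric] ..
  also have "\<dots> = complex_of_real (\<Sum>b\<in>{1..<L}. \<Sum>a\<in>{1..<M}. (?g a + ?h b) * (cmod (?W b a))\<^sup>2)"
    by (simp only: of_real_sum)
  also have "(\<Sum>b\<in>{1..<L}. \<Sum>a\<in>{1..<M}. (?g a + ?h b) * (cmod (?W b a))\<^sup>2) =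
      (\<Sum>y\<in>{1..<L}. \<Sum>a\<in>{1..<M}. ?g a * (cmod (dst M (V y) a))\<^sup>2) +
      (\<Sum>x\<in>{1..<M}. \<Sum>b\<in>{1..<L}. ?h b * (cmod (dst L (\<lambda>y. V y x) b))\<^sup>2)"
    by (rule dst2_form_split)
  finally show ?thesis .
qed

lemma toeplitz_mat_form:
  assumes "continuous_on {-pi..pi} f" "\<And>t. t \<in> {-pi..pi} \<Longrightarrow> g t = complex_of_real (f t)"
  shows "(\<Sum>i<n. \<Sum>i'<n. cnj (u (int i + 1)) * toeplitz n g $$ (i, i') * u (int i' + 1)) =
    of_real (mean (\<lambda>t. f t * (cmod (trig {1..<int n + 1} u t))\<^sup>2))"
proof -
  have c: "continuous_on {-pi..pi} (\<lambda>t. complex_of_real (f t))"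
    using assms(1) by (intro continuous_intros)
  have "(\<Sum>i<n. \<Sum>i'<n. cnj (u (int i + 1)) * toeplitz n g $$ (i, i') * u (int i' + 1)) =
      (\<Sum>i<n. \<Sum>i'<n. cnj (u (int i + 1)) * coef (\<lambda>t. of_real (f t)) ((int i + 1) - (int i' + 1)) * u (int i' + 1))"
    using fourier_coeff_eq_coef[OF c, of g] assms(2) by (intro sum.cong refl) (simp add: toeplitz_def)
  also have "\<dots> = of_real (mean (\<lambda>t. f t * (cmod (trig {1..<int n + 1} u t))\<^sup>2))"
    unfolding sum_int_shift[where g = "\<lambda>x'. cnj (u (int _ + 1)) * coef (\<lambda>t. of_real (f t)) ((int _ + 1) - x') * u x'"]
      sum_int_shift[where g = "\<lambda>x. \<Sum>x'\<in>{1..<int n + 1}. cnj (u x) * coef (\<lambda>t. of_real (f t)) (x - x') * u x'"]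
    by (rule toeplitz_form[OF assms(1)]) simp
  finally show ?thesis .
qed

text \<open>The sum runs over the same grid lines as in \<open>precond_form\<close>, with a Toeplitz
  form in place of each sine form, so the two can be compared term by term.\<close>

lemma coeff_form:
  assumes v: "v \<in> carrier_vec (n\<^sub>2 * n\<^sub>1)" and \<alpha>: "\<alpha> > 0" and \<beta>: "\<beta> > 0"
  defines "V \<equiv> \<lambda>y x. v $ (nat (y - 1) * n\<^sub>1 + nat (x - 1))"
    and "L \<equiv> int n\<^sub>2 + 1" and "M \<equiv> int n\<^sub>1 + 1"
  shows "quad_form (coeff_mat \<alpha> \<beta> d e r s n\<^sub>1 n\<^sub>2) v = of_real
    ((\<Sum>y\<in>{1..<L}. mean (\<lambda>t. (1 / r + d * q_real \<alpha> t) * (cmod (trig {1..<M} (V y) t))\<^sup>2)) +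
     (\<Sum>x\<in>{1..<M}. mean (\<lambda>t. (0 + e * (s / r) * q_real \<beta> t) * (cmod (trig {1..<L} (\<lambda>y. V y x) t))\<^sup>2)))"
proof -
  let ?S = "toeplitz n\<^sub>1 (\<lambda>\<theta>. of_real (1 / r) + of_real d * q_symbol \<alpha> \<theta>)"
    and ?T = "toeplitz n\<^sub>2 (\<lambda>\<theta>. of_real (e * (s / r)) * q_symbol \<beta> \<theta>)"
  have VW: "v $ (j * n\<^sub>1 + i) = V (int j + 1) (int i + 1)" for i j
    by (simp add: V_def)
  have "quad_form (coeff_mat \<alpha> \<beta> d e r s n\<^sub>1 n\<^sub>2) v =
    (\<Sum>j<n\<^sub>2. \<Sum>i<n\<^sub>1. \<Sum>i'<n\<^sub>1. cnj (V (int j + 1) (int i + 1)) * ?S $$ (i, i') * V (int j + 1) (int i' + 1)) +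
    (\<Sum>i<n\<^sub>1. \<Sum>j<n\<^sub>2. \<Sum>j'<n\<^sub>2. cnj (V (int j + 1) (int i + 1)) * ?T $$ (j, j') * V (int j' + 1) (int i + 1))"
    unfolding coeff_mat_def VW[symmetric]
    by (rule quad_form_kron_sum[OF _ _ v]) (simp_all add: toeplitz_def)
  also have "(\<Sum>j<n\<^sub>2. \<Sum>i<n\<^sub>1. \<Sum>i'<n\<^sub>1. cnj (V (int j + 1) (int i + 1)) * ?S $$ (i, i') * V (int j + 1) (int i' + 1)) =
      (\<Sum>j<n\<^sub>2. complex_of_real (mean (\<lambda>t. (1 / r + d * q_real \<alpha> t) * (cmod (trig {1..<M} (V (int j + 1)) t))\<^sup>2)))"
    unfolding M_def using \<alpha>
    by (intro sum.cong refl toeplitz_mat_form continuous_intros) (simp_all add: q_symbol_eq_q_real)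
  also have "\<dots> = (\<Sum>y\<in>{1..<L}. complex_of_real (mean (\<lambda>t. (1 / r + d * q_real \<alpha> t) * (cmod (trig {1..<M} (V y) t))\<^sup>2)))"
    unfolding L_def by (rule sum_int_shift)
  also have "(\<Sum>i<n\<^sub>1. \<Sum>j<n\<^sub>2. \<Sum>j'<n\<^sub>2. cnj (V (int j + 1) (int i + 1)) * ?T $$ (j, j') * V (int j' + 1) (int i + 1)) =
      (\<Sum>i<n\<^sub>1. complex_of_real (mean (\<lambda>t. (0 + e * (s / r) * q_real \<beta> t) *
        (cmod (trig {1..<L} (\<lambda>y. V y (int i + 1)) t))\<^sup>2)))"
    unfolding L_def using \<beta>
    by (intro sum.cong refl toeplitz_mat_form[where u = "\<lambda>y. V y (int _ + 1)"] continuous_intros)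
      (simp_all add: q_symbol_eq_q_real)
  also have "\<dots> = (\<Sum>x\<in>{1..<M}. complex_of_real (mean (\<lambda>t. (0 + e * (s / r) * q_real \<beta> t) *
        (cmod (trig {1..<L} (\<lambda>y. V y x) t))\<^sup>2)))"
    unfolding M_def by (rule sum_int_shift)
  finally show ?thesis by (simp only: of_real_add of_real_sum)
qed

text \<open>Every grid line is compared in one dimension, with shift \<open>1 / r\<close> in
  \<open>x\<close> and shift 0 in \<open>y\<close>; sums keep such bounds with the larger of the two
  constants.\<close>

lemma coeff_precond_spectrum:
  fixes n\<^sub>1 n\<^sub>2 :: nat
  assumes \<alpha>: "1 < \<alpha>" "\<alpha> < 2" and \<beta>: "1 < \<beta>" "\<beta> < 2" and d: "d > 0" and e: "e > 0"
    and r: "r > 0" and s: "s > 0"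
  defines "K \<equiv> max (equiv_const \<alpha>) (equiv_const \<beta>)"
    and "P \<equiv> precond_mat \<alpha> \<beta> d e r s n\<^sub>1 n\<^sub>2"
  shows "invertible_mat P \<and>
    spectrum (the (mat_inverse P) * coeff_mat \<alpha> \<beta> d e r s n\<^sub>1 n\<^sub>2) \<subseteq> complex_of_real ` {1 / K..K}"
proof (rule spectrum_pencil_bounds)
  let ?N = "n\<^sub>2 * n\<^sub>1" and ?L = "int n\<^sub>2 + 1" and ?M = "int n\<^sub>1 + 1"
  let ?V = "\<lambda>v y x. v $ (nat (y - 1) * n\<^sub>1 + nat (x - 1)) :: complex"
  let ?c = "e * (s / r)"
  define a1 where "a1 v y = mean (\<lambda>t. (1 / r + d * q_real \<alpha> t) * (cmod (trig {1..<?M} (?V v y) t))\<^sup>2)" for v y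
  define a2 where "a2 v x = mean (\<lambda>t. (0 + ?c * q_real \<beta> t) * (cmod (trig {1..<?L} (\<lambda>y. ?V v y x) t))\<^sup>2)" for v x
  define p1 where "p1 v y = (\<Sum>a\<in>{1..<?M}. (1 / r + d * q_real \<alpha> (of_int a * pi / of_int ?M)) *
    (cmod (dst ?M (?V v y) a))\<^sup>2)" for v y
  define p2 where "p2 v x = (\<Sum>b\<in>{1..<?L}. (0 + ?c * q_real \<beta> (of_int b * pi / of_int ?L)) *
    (cmod (dst ?L (\<lambda>y. ?V v y x) b))\<^sup>2)" for v x
  show "coeff_mat \<alpha> \<beta> d e r s n\<^sub>1 n\<^sub>2 \<in> carrier_mat ?N ?N"
    by (simp add: coeff_mat_def kron_def toeplitz_def)
  show "P \<in> carrier_mat ?N ?N"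
    unfolding P_def precond_mat_def by (intro mult_carrier_mat[of _ _ ?N])
      (simp_all add: kron_def sine_mat_def F_mat_def mat_diag_blocks)
  have K: "K \<ge> equiv_const \<alpha>" "K \<ge> equiv_const \<beta>" by (simp_all add: K_def)
  with equiv_const_ge[OF \<alpha>] show "K > 0" by linarith
  define a where "a v = (\<Sum>y\<in>{1..<?L}. a1 v y) + (\<Sum>x\<in>{1..<?M}. a2 v x)" for v
  define p where "p v = (\<Sum>y\<in>{1..<?L}. p1 v y) + (\<Sum>x\<in>{1..<?M}. p2 v x)" for v
  fix v :: "complex Matrix.vec" assume v: "v \<in> carrier_vec ?N" "v \<noteq> 0\<^sub>v ?N"
  have A: "quad_form (coeff_mat \<alpha> \<beta> d e r s n\<^sub>1 n\<^sub>2) v = complex_of_real (a v)"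
    unfolding a_def a1_def a2_def using \<alpha> \<beta> by (intro coeff_form[OF v(1)]) auto
  have Pf: "quad_form P v = complex_of_real (p v)"
    unfolding P_def p_def p1_def p2_def using \<alpha> \<beta> by (intro precond_form[OF v(1)]) auto
  have c: "?c > 0" using e s r by simp
  have ap1: "a1 v y \<le> equiv_const \<alpha> * p1 v y" "p1 v y \<le> equiv_const \<alpha> * a1 v y" for y
    unfolding a1_def p1_def using \<alpha> d r by (intro shifted_q_form_equiv; simp)+
  have ap2: "a2 v x \<le> equiv_const \<beta> * p2 v x" "p2 v x \<le> equiv_const \<beta> * a2 v x" for x
    unfolding a2_def p2_def using \<beta> c by (intro shifted_q_form_equiv; simp)+
  \<comment> \<open>Strict positivity rests on \<open>1 / r\<close>: the symbol adds a nonnegative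
    amount, and Parseval returns the squared norm of the line.\<close>
  have p1: "p1 v y \<ge> 1 / r * (\<Sum>x\<in>{1..<?M}. (cmod (?V v y x))\<^sup>2)" for y
    unfolding p1_def dst_parseval[of ?M "?V v y", symmetric] sum_distrib_left
  proof (intro sum_mono mult_right_mono)
    fix a assume "a \<in> {1..<?M}"
    then have "0 \<le> d * q_real \<alpha> (of_int a * pi / of_int ?M)"
      using d by (intro mult_nonneg_nonneg q_real_bounds(3)[OF \<alpha> grid_in_period]) auto
    then show "1 / r \<le> 1 / r + d * q_real \<alpha> (of_int a * pi / of_int ?M)" by linarith
  qed simp
  have p2: "p2 v x \<ge> 0" for x
    unfolding p2_def add_0_left
    using e s r by (intro sum_nonneg mult_nonneg_nonneg q_real_bounds(3)[OF \<beta> grid_in_period]) auto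
  have p1_nonneg: "p1 v y \<ge> 0" for y
    using order_trans[OF _ p1[of y], of 0] r by (simp add: sum_nonneg)
  \<comment> \<open>Inherited from the sine forms through the second halves of \<open>ap1\<close>
    and \<open>ap2\<close>; it allows the constants of the separate orders to be raised to their
    maximum.\<close>
  have a_nonneg: "a1 v y \<ge> 0" "a2 v x \<ge> 0" for x y
    using ap1(2)[of y] ap2(2)[of x] p1_nonneg[of y] p2[of x] equiv_const_ge[OF \<alpha>] equiv_const_ge[OF \<beta>]
    by (smt (verit) mult_pos_neg)+
  have "a1 v y \<le> K * p1 v y" "p1 v y \<le> K * a1 v y" "a2 v x \<le> K * p2 v x" "p2 v x \<le> K * a2 v x" for x y
    using ap1[of y] ap2[of x] K mult_right_mono[OF K(1) p1_nonneg[of y]] mult_right_mono[OF K(2) p2[of x]]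
      mult_right_mono[OF K(1) a_nonneg(1)[of y]] mult_right_mono[OF K(2) a_nonneg(2)[of x]] by linarith+
  then have "a v \<le> K * p v" "p v \<le> K * a v"
    unfolding a_def p_def distrib_left sum_distrib_left by (intro add_mono sum_mono; simp)+
  moreover have "p v > 0"
  proof -
    obtain k where k: "k < ?N" "v $ k \<noteq> 0"
      using v by (metis carrier_vecD eq_vecI index_zero_vec(1) index_zero_vec(2))
    then have n1: "n\<^sub>1 > 0" by (cases n\<^sub>1) auto
    define y x where "y = int (k div n\<^sub>1) + 1" and "x = int (k mod n\<^sub>1) + 1"
    have y: "y \<in> {1..<?L}" and x: "x \<in> {1..<?M}"
    proof -
      have "int (k div n\<^sub>1) < int n\<^sub>2" "int (k mod n\<^sub>1) < int n\<^sub>1"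
        using k n1 by (simp_all only: of_nat_less_iff less_mult_imp_div_less mod_less_divisor)
      then show "y \<in> {1..<?L}" "x \<in> {1..<?M}"
        unfolding y_def x_def by auto
    qed
    have "?V v y x = v $ k" by (simp add: y_def x_def)
    then have "0 < (cmod (?V v y x))\<^sup>2" using k by simp
    also have "\<dots> \<le> (\<Sum>x\<in>{1..<?M}. (cmod (?V v y x))\<^sup>2)"
      by (rule member_le_sum[OF x]) auto
    finally have "0 < 1 / r * (\<Sum>x\<in>{1..<?M}. (cmod (?V v y x))\<^sup>2)"
      using r by simp
    also have "\<dots> \<le> p1 v y" by (rule p1)
    also have "\<dots> \<le> (\<Sum>y\<in>{1..<?L}. p1 v y)"
      by (rule member_le_sum[OF y]) (auto simp: p1_nonneg)
    also have "\<dots> \<le> p v" unfolding p_def by (simp add: sum_nonneg p2)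
    finally show ?thesis .
  qed
  ultimately show "quad_form (coeff_mat \<alpha> \<beta> d e r s n\<^sub>1 n\<^sub>2) v = complex_of_real (a v) \<and>
      quad_form P v = complex_of_real (p v) \<and> p v > 0 \<and> a v \<le> K * p v \<and> p v \<le> K * a v"
    using A Pf by simp
qed

lemma mesh_ratio_pos:
  assumes "L < R" "T > 0" "M > 0"
  shows "mesh_ratio \<gamma> L R T n M > 0"
  using assms by (simp add: mesh_ratio_def Let_def)

theorem theorem3:
  fixes \<alpha> \<beta> d e L\<^sub>1 R\<^sub>1 L\<^sub>2 R\<^sub>2 T :: real
  assumes "1 < \<alpha>" "\<alpha> < 2" and "1 < \<beta>" "\<beta> < 2"
    and "d > 0" and "e > 0"
    and "L\<^sub>1 < R\<^sub>1" and "L\<^sub>2 < R\<^sub>2" and "T > 0"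
  shows "\<exists>c C :: real. 0 < c \<and> c \<le> C \<and>
    (\<forall>n\<^sub>1 n\<^sub>2 M :: nat. n\<^sub>1 > 0 \<longrightarrow> n\<^sub>2 > 0 \<longrightarrow> M > 0 \<longrightarrow>
      (let r = mesh_ratio \<alpha> L\<^sub>1 R\<^sub>1 T n\<^sub>1 M;
           s = mesh_ratio \<beta> L\<^sub>2 R\<^sub>2 T n\<^sub>2 M;
           A = coeff_mat \<alpha> \<beta> d e r s n\<^sub>1 n\<^sub>2;
           P = precond_mat \<alpha> \<beta> d e r s n\<^sub>1 n\<^sub>2
       in invertible_mat P \<and>
          spectrum (the (mat_inverse P) * A) \<subseteq> complex_of_real ` {c..C}))"
proof -
  \<comment> \<open>This depends on the two orders only, and is thus fixed before the mesh and the
    number of time steps are chosen.\<close>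
  define K where "K = max (equiv_const \<alpha>) (equiv_const \<beta>)"
  have "K \<ge> 20" using equiv_const_ge[OF assms(1,2)] by (simp add: K_def le_max_iff_disj)
  then have "0 < 1 / K" "1 / K \<le> K"
    by (simp_all add: divide_le_eq mult_ge1_I)
  show ?thesis
  proof (intro exI conjI allI impI)
    show "0 < 1 / K" "1 / K \<le> K" by fact+
    fix n\<^sub>1 n\<^sub>2 M :: nat
    assume "n\<^sub>1 > 0" "n\<^sub>2 > 0" "M > 0"
    then show "let r = mesh_ratio \<alpha> L\<^sub>1 R\<^sub>1 T n\<^sub>1 M;
           s = mesh_ratio \<beta> L\<^sub>2 R\<^sub>2 T n\<^sub>2 M;
           A = coeff_mat \<alpha> \<beta> d e r s n\<^sub>1 n\<^sub>2;
           P = precond_mat \<alpha> \<beta> d e r s n\<^sub>1 n\<^sub>2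
       in invertible_mat P \<and>
          spectrum (the (mat_inverse P) * A) \<subseteq> complex_of_real ` {1 / K..K}"
      unfolding Let_def K_def
      by (intro coeff_precond_spectrum assms mesh_ratio_pos)
  qed
qed

end
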